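(* Let $T\in(0,\infty)$, $d\in\mathbb{N}$, $u_0\in\mathbb{R}^d$, $p\in(2,\infty)$, and let $f\colon[0,T]\times\mathbb{R}^d\to\mathbb{R}^d$ be measurable. Suppose there are measurable mappings $L,K\colon[0,T]\to[0,\infty)$ with $\|L\|_{L^p([0,T];\mathbb{R})}<\infty$ and $\|K\|_{L^p([0,T];\mathbb{R})}<\infty$ such that for almost all $t\in[0,T]$ and all $x_1,x_2\in\mathbb{R}^d$ $$|f(t,x_1)-f(t,x_2)|\le L(t)|x_1-x_2|,$$ and $|f(t,0)|\le K(t)$ for almost all $t\in[0,T]$. Let $u$ denote the exact solution to $\dot u(t)=f(t,u(t))$, $t\in[0,T]$, $u(0)=u_0$. Let $(h_m)_{m\in\mathbb{N}}\subset(0,1)$ be a given sequence of step sizes with $\sum_{m=1}^\infty h_m<\infty$, and for each $m\in\mathbb{N}$ let $(U^j_m)_{j\in\{0,1,\ldots,N_{h_m}\}}$ be the randomized Euler approximation with step size $h_m$, determined by $U^0_m=u_0$ and $$U^j_m=U^{j-1}_m+h_mf\big((j-1)h_m+\tau_jh_m,U^{j-1}_m\big),\quad j\in\{1,\ldots,N_{h_m}\}.$$ Then there exist a random variable $m_0\colon\Omega\to\mathbb{N}_0$ and a measurable set $A\in\mathcal{F}$ with $\mathbb{P}(A)=1$ such that for every $\omega\in A$ and $m\ge m_0(\omega)$ $$\max_{n\in\{0,1,\ldots,N_{h_m}\}}|u(t_n)-U^n_m(\omega)|\le h_m^{\frac12-\frac1p},$$ where $t_n=nh_m$.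
   Context: $|\cdot|$ is the Euclidean norm on $\mathbb{R}^d$ and $\mathbb{N}_0=\mathbb{N}\cup\{0\}$. $(\tau_j)_{j\in\mathbb{N}}$ is an independent family of random variables, each uniformly distributed on $(0,1)$, on a probability space $(\Omega,\mathcal{F},\mathbb{P})$. For $h\in(0,1)$, $N_h\in\mathbb{N}_0$ is the integer determined by $N_hh\le T<(N_h+1)h$. A solution of the initial value problem is an absolutely continuous $u\colon[0,T]\to\mathbb{R}^d$ with $u(t)=u_0+\int_0^tf(s,u(s))\,\mathrm{d}s$ for all $t\in[0,T]$ (in particular $t\mapsto f(t,u(t))$ is integrable). Under the stated hypotheses on $f$ there is a unique solution. *)

theory Defs
  imports "HOL-Probability.Probability"
begin

definition absolutely_continuous_on_Icc ::
    "real \<Rightarrow> real \<Rightarrow> (real \<Rightarrow> 'a::real_normed_vector) \<Rightarrow> bool" where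
  "absolutely_continuous_on_Icc a b u \<longleftrightarrow>
     (\<forall>\<epsilon>>0. \<exists>\<delta>>0. \<forall>(n::nat) l r.
        (\<forall>i<n. a \<le> l i \<and> l i \<le> r i \<and> r i \<le> b) \<and>
        (\<forall>i<n. \<forall>j<n. i \<noteq> j \<longrightarrow> {l i<..<r i} \<inter> {l j<..<r j} = {}) \<and>
        (\<Sum>i<n. r i - l i) < \<delta>
        \<longrightarrow> (\<Sum>i<n. norm (u (r i) - u (l i))) < \<epsilon>)"

text \<open>
  The Bochner integral is \<open>0\<close> on non-integrable functions, so integrability of
  \<open>t \<mapsto> f(t, u(t))\<close> is required separately.
\<close>

definition ivp_solution ::
    "real \<Rightarrow> (real \<Rightarrow> 'a \<Rightarrow> 'a) \<Rightarrow> 'a \<Rightarrow> (real \<Rightarrow> 'a::euclidean_space) \<Rightarrow> bool" where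
  "ivp_solution T f u0 u \<longleftrightarrow>
     absolutely_continuous_on_Icc 0 T u \<and>
     set_integrable lborel {0..T} (\<lambda>s. f s (u s)) \<and>
     (\<forall>t\<in>{0..T}. u t = u0 + (LINT s:{0..t}|lborel. f s (u s)))"

definition num_steps :: "real \<Rightarrow> real \<Rightarrow> nat" where
  "num_steps T h = (THE N. real N * h \<le> T \<and> T < (real N + 1) * h)"

lemma num_steps_unique:
  assumes "0 \<le> T" "0 < h"
  shows "\<exists>!N. real N * h \<le> T \<and> T < (real N + 1) * h"
proof -
  have iff: "real N * h \<le> T \<and> T < (real N + 1) * h \<longleftrightarrow> \<lfloor>T / h\<rfloor> = int N" for N
    using assms by (simp add: floor_eq_iff pos_le_divide_eq pos_divide_less_eq)
  have "0 \<le> \<lfloor>T / h\<rfloor>"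
    using assms by simp
  then have "\<exists>!N. \<lfloor>T / h\<rfloor> = int N"
    by (metis nat_int nonneg_int_cases)
  then show ?thesis
    by (simp only: iff)
qed

lemma num_steps_bounds:
  assumes "0 \<le> T" "0 < h"
  shows "real (num_steps T h) * h \<le> T" "T < (real (num_steps T h) + 1) * h"
  using theI'[OF num_steps_unique[OF assms]] by (simp_all add: num_steps_def)

text \<open>
  One trajectory of the scheme: \<open>\<theta> j\<close> is the realisation of \<open>\<tau>\<^sub>j\<close>, used for \<open>j \<ge> 1\<close>
  only. The step from \<open>j\<close> to \<open>Suc j\<close> starts at time \<open>j * h\<close>.
\<close>

primrec randomized_euler ::
    "(real \<Rightarrow> 'a \<Rightarrow> 'a) \<Rightarrow> 'a \<Rightarrow> real \<Rightarrow> (nat \<Rightarrow> real) \<Rightarrow> nat \<Rightarrow> 'a::real_vector" where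
  "randomized_euler f u0 h \<theta> 0 = u0"
| "randomized_euler f u0 h \<theta> (Suc j) =
     randomized_euler f u0 h \<theta> j +
     h *\<^sub>R f (real j * h + \<theta> (Suc j) * h) (randomized_euler f u0 h \<theta> j)"

end

theory Submission
  imports Defs
begin

text \<open>
  Put \<open>g t = f t (u t)\<close>. Over one step the error \<open>x\<close> changes by \<open>y + z\<close>, where
  \<open>y\<close> is the difference of the integral of \<open>g\<close> over the step and its randomized one-point
  quadrature, which has mean zero given the past, and \<open>z\<close> is controlled by the Lipschitz bound at the random node.
  Since the node is independent of \<open>x\<close>, taking expectations in
  \<open>norm (x + w) powr p \<le> norm x powr p + p * norm x powr (p - 2) * (x \<bullet> w) + \<dots>\<close>
  removes the term linear in \<open>y\<close> and leaves a recursion to which the discrete Gronwall argument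
  applies; the \<open>p\<close>-th moment of the error is therefore of order \<open>h powr (p / 2)\<close>. By Markov's
  inequality the threshold \<open>h powr (1/2 - 1/p)\<close> is exceeded with probability of order \<open>h\<close>, and
  the Borel--Cantelli lemma concludes.
\<close>

section \<open>Inequalities for powers of norms\<close>

text \<open>The tangent line inequality for a convex power. Convexity is derived from the derivative
  on the open half-line, so the boundary is treated separately; at \<open>c = 0\<close> the left
  side is zero even for \<open>q = 1\<close>, because \<open>0 powr 0 = 0\<close>.\<close>

lemma powr_above_tangent:
  fixes x c q :: real
  assumes "1 \<le> q" "0 \<le> c" "0 \<le> x"
  shows "c powr q + q * c powr (q - 1) * (x - c) \<le> x powr q"
proof (cases "c = 0 \<or> x = 0")
  case True
  show ?thesis
  proof (cases "c = 0")
    case False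
    then have "x = 0" "0 < c" using True assms by auto
    moreover from \<open>0 < c\<close> have "c powr q = c powr (q - 1) * c"
      by (metis diff_add_cancel less_imp_le powr_add powr_one)
    moreover have "0 \<le> (q - 1) * (c powr (q - 1) * c)"
      using assms by simp
    ultimately show ?thesis by (simp add: algebra_simps)
  qed (use assms in auto)
next
  case False
  then have pos: "0 < c" "0 < x" using assms by auto
  have "convex_on {0<..} (\<lambda>x. x powr q)"
    by (rule convex_on_realI[where f' = "\<lambda>x. q * x powr (q - 1)"])
       (use assms in \<open>auto intro!: derivative_eq_intros powr_mono2 mult_left_mono\<close>)
  then have "x powr q - c powr q \<ge> q * c powr (q - 1) * (x - c)"
    by (rule convex_on_imp_above_tangent)
       (use pos in \<open>auto simp: interior_open intro!: derivative_eq_intros\<close>)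
  then show ?thesis by simp
qed

text \<open>Both factors have the same sign. For \<open>s \<ge> 1\<close> the slope of
  \<open>r powr s\<close> on \<open>[0, R]\<close> is at most \<open>s * R powr s\<close>; for
  \<open>s < 1\<close> the value \<open>r powr s\<close> lies between \<open>r\<close> and
  \<open>1\<close>, which accounts for the summand \<open>1\<close>.\<close>

lemma powr_minus_one_mult_le:
  fixes r s R :: real
  assumes "0 \<le> s" "0 \<le> r" "r \<le> R" "1 \<le> R"
  shows "(r powr s - 1) * (r - 1) \<le> (1 + s * R powr s) * (r - 1)\<^sup>2"
proof (cases "1 \<le> s")
  case True
  have "(r powr s - 1) * (r - 1) \<le> s * R powr s * (r - 1)\<^sup>2"
  proof (cases "1 \<le> r")
    case r: True
    have "r powr s - 1 \<le> s * r powr (s - 1) * (r - 1)"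
      using powr_above_tangent[of s r 1] True r by (simp add: algebra_simps)
    also have "\<dots> \<le> s * R powr s * (r - 1)"
      using True r assms by (intro mult_right_mono mult_left_mono powr_mono_both) auto
    finally show ?thesis
      using r by (auto simp: power2_eq_square mult.assoc[symmetric] intro!: mult_right_mono)
  next
    case r: False
    have "s * (r - 1) \<le> r powr s - 1"
      using powr_above_tangent[of s 1 r] True assms by (simp add: algebra_simps)
    then have "(r powr s - 1) * (r - 1) \<le> s * (r - 1) * (r - 1)"
      using r by (intro mult_right_mono_neg) auto
    also have "\<dots> = s * 1 * (r - 1)\<^sup>2" by (simp add: power2_eq_square)
    also have "\<dots> \<le> s * R powr s * (r - 1)\<^sup>2"
      using True assms by (intro mult_right_mono mult_left_mono ge_one_powr_ge_zero) auto
    finally show ?thesis .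
  qed
  then show ?thesis using zero_le_power2[of "r - 1"] unfolding distrib_right mult_1_left by linarith
next
  case False
  have "(r powr s - 1) * (r - 1) \<le> 1 * (r - 1)\<^sup>2"
  proof (cases "1 \<le> r")
    case r: True
    have "r powr s \<le> r powr 1" using r False by (intro powr_mono) auto
    then show ?thesis using r by (auto simp: power2_eq_square intro!: mult_right_mono)
  next
    case r: False
    have "r powr 1 \<le> r powr s" using r False assms by (intro powr_mono') auto
    then show ?thesis using r assms
      by (auto simp: power2_eq_square intro!: mult_right_mono_neg)
  qed
  also have "\<dots> \<le> (1 + s * R powr s) * (r - 1)\<^sup>2"
    using assms by (intro mult_right_mono) auto
  finally show ?thesis .
qed

text \<open>The tangent is taken at \<open>r\<close> rather than at \<open>1\<close>, and its slope
  is then compared with the slope at \<open>1\<close>. The remainder is thus quadratic also for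
  \<open>1 < q < 2\<close>, where the second derivative is unbounded near zero.\<close>

lemma powr_second_order_le:
  fixes r q R :: real
  assumes "1 \<le> q" "0 \<le> r" "r \<le> R" "1 \<le> R"
  shows "r powr q \<le> 1 + q * (r - 1) + q * (1 + (q - 1) * R powr (q - 1)) * (r - 1)\<^sup>2"
proof -
  have "r powr q - 1 \<le> q * (r powr (q - 1) * (r - 1))"
    using powr_above_tangent[of q r 1] assms by (simp add: algebra_simps)
  moreover have "q * ((r powr (q - 1) - 1) * (r - 1))
      \<le> q * ((1 + (q - 1) * R powr (q - 1)) * (r - 1)\<^sup>2)"
    using assms by (intro mult_left_mono powr_minus_one_mult_le) auto
  ultimately show ?thesis by (simp add: algebra_simps)
qed

lemma powr_add_le:
  fixes a b p :: real
  assumes "0 \<le> a" "0 \<le> b" "0 \<le> p"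
  shows "(a + b) powr p \<le> 2 powr p * (a powr p + b powr p)"
proof -
  have "(a + b) powr p \<le> (2 * max a b) powr p"
    using assms by (intro powr_mono2) auto
  also have "\<dots> = 2 powr p * max a b powr p"
    using assms by (simp add: powr_mult)
  also have "max a b powr p \<le> a powr p + b powr p"
    by (simp add: max_def)
  finally show ?thesis by simp
qed

text \<open>Young's inequality with crude constants: the product is at most the \<open>p\<close>-th
  power of the larger number.\<close>

lemma powr_pred_mult_le:
  fixes a b p :: real
  assumes "0 \<le> a" "0 \<le> b" "1 \<le> p"
  shows "a powr (p - 1) * b \<le> a powr p + b powr p"
proof -
  have split: "z powr p = z powr (p - 1) * z" if "0 \<le> z" for z
    using that by (cases "z = 0") (auto simp flip: powr_add powr_mult_base simp: mult.commute powr_mult_base)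
  show ?thesis
  proof (cases "b \<le> a")
    case True
    then have "a powr (p - 1) * b \<le> a powr p"
      using assms by (auto simp: split intro: mult_left_mono)
    then show ?thesis by (simp add: add_increasing2)
  next
    case False
    then have "a powr (p - 1) * b \<le> b powr p"
      using assms by (auto simp: split intro!: mult_right_mono powr_mono2)
    then show ?thesis by (simp add: add_increasing)
  qed
qed

lemma powr_diff_two_mult_square:
  fixes z p :: real
  assumes "0 \<le> z"
  shows "z powr (p - 2) * z\<^sup>2 = z powr p"
  using assms by (cases "z = 0") (auto simp: powr_diff)

text \<open>A second-order Taylor bound that keeps the linear term exactly, so that centring can
  remove it later. If \<open>norm x \<le> norm w\<close>, everything is absorbed by
  \<open>norm w powr p\<close>; otherwise the scalar expansion with exponent \<open>p / 2\<close> is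
  applied to the ratio of the squared norms of \<open>x + w\<close> and \<open>x\<close>.\<close>

lemma ex_norm_powr_add_le:
  fixes p :: real
  assumes "2 \<le> p"
  shows "\<exists>C\<ge>1. \<forall>x w :: 'a::real_inner.
    norm (x + w) powr p \<le> norm x powr p + p * norm x powr (p - 2) * (x \<bullet> w)
      + C * (norm x powr (p - 2) * (norm w)\<^sup>2 + norm w powr p)"
proof -
  define q where "q = p / 2"
  \<comment> \<open>\<open>K\<close> is the scalar remainder constant for \<open>R = 4\<close>: in
    the second case \<open>norm (x + w) \<le> 2 * norm x\<close>, so the squared ratio is at most 4.
    \<open>C\<close> collects what the two cases require.\<close>
  define K where "K = q * (1 + (q - 1) * 4 powr (q - 1))"
  define C where "C = 1 + 2 powr p + p + q + 9 * K"
  have q: "1 \<le> q" "p = 2 * q" using assms by (auto simp: q_def)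
  have K: "0 \<le> K" using q by (simp add: K_def)
  have C: "1 \<le> C" "2 powr p + p \<le> C" "q + 9 * K \<le> C"
    using q K by (auto simp: C_def)
  have "norm (x + w) powr p \<le> norm x powr p + p * norm x powr (p - 2) * (x \<bullet> w)
      + C * (norm x powr (p - 2) * (norm w)\<^sup>2 + norm w powr p)" for x w :: 'a
  proof (cases "norm x \<le> norm w")
    case True
    have "norm (x + w) powr p \<le> (2 * norm w) powr p"
      using assms norm_triangle_ineq[of x w] True by (intro powr_mono2) auto
    also have "\<dots> = 2 powr p * norm w powr p" by (simp add: powr_mult)
    finally have 1: "norm (x + w) powr p \<le> 2 powr p * norm w powr p" .
    have "\<bar>norm x powr (p - 2) * (x \<bullet> w)\<bar> = norm x powr (p - 2) * \<bar>x \<bullet> w\<bar>"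
      by (simp add: abs_mult)
    also have "\<dots> \<le> norm w powr (p - 2) * (norm w)\<^sup>2"
    proof (rule mult_mono)
      show "norm x powr (p - 2) \<le> norm w powr (p - 2)"
        using True assms by (intro powr_mono2) auto
      have "\<bar>x \<bullet> w\<bar> \<le> norm x * norm w" by (rule Cauchy_Schwarz_ineq2)
      also have "\<dots> \<le> norm w * norm w" using True by (intro mult_right_mono) auto
      finally show "\<bar>x \<bullet> w\<bar> \<le> (norm w)\<^sup>2" by (simp add: power2_eq_square)
    qed auto
    also have "\<dots> = norm w powr p" by (simp add: powr_diff_two_mult_square)
    finally have "- (norm w powr p) \<le> norm x powr (p - 2) * (x \<bullet> w)" by linarith
    then have "p * (- (norm w powr p)) \<le> p * (norm x powr (p - 2) * (x \<bullet> w))"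
      using assms by (intro mult_left_mono) auto
    moreover have "(2 powr p + p) * norm w powr p
        \<le> C * (norm x powr (p - 2) * (norm w)\<^sup>2 + norm w powr p)"
      using C assms by (intro mult_mono) auto
    ultimately show ?thesis
      using 1 powr_ge_zero[of "norm x" p] unfolding distrib_right mult_minus_right mult.assoc by linarith
  next
    case False
    define n where "n = norm x"
    define r where "r = (norm (x + w))\<^sup>2 / n\<^sup>2"
    define b where "b = 2 * (x \<bullet> w) + (norm w)\<^sup>2"
    have n: "0 < n" "norm w \<le> n" using False norm_ge_zero[of w] by (auto simp: n_def simp del: norm_ge_zero)
    have "(norm (x + w))\<^sup>2 = n\<^sup>2 + b"
      by (simp add: n_def b_def power2_norm_eq_inner inner_add_left inner_add_right inner_commute)
    then have r1: "r - 1 = b / n\<^sup>2" using n by (simp add: r_def field_simps)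
    have "norm (x + w) \<le> 2 * n" using norm_triangle_ineq[of x w] n by (simp add: n_def)
    then have "(norm (x + w))\<^sup>2 \<le> (2 * n)\<^sup>2" by (intro power_mono) auto
    then have r4: "r \<le> 4" "0 \<le> r" using n by (auto simp: r_def field_simps)
    \<comment> \<open>Since \<open>norm w \<le> n\<close>, the square is absorbed into
      \<open>n * norm w\<close>; the resulting factor 3 is the source of the 9 in
      \<open>C\<close>.\<close>
    have "\<bar>b\<bar> \<le> 2 * \<bar>x \<bullet> w\<bar> + (norm w)\<^sup>2"
      using abs_triangle_ineq[of "2 * (x \<bullet> w)" "(norm w)\<^sup>2"] by (simp add: b_def abs_mult)
    also have "\<dots> \<le> 2 * (n * norm w) + n * norm w"
      using Cauchy_Schwarz_ineq2[of x w] n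
      by (intro add_mono mult_left_mono) (auto simp: n_def power2_eq_square intro: mult_right_mono)
    finally have "\<bar>b\<bar> \<le> 3 * (n * norm w)" by simp
    then have "b\<^sup>2 \<le> (3 * (n * norm w))\<^sup>2" by (rule power2_le_iff_abs_le[THEN iffD2, rotated]) (use n in auto)
    then have "(r - 1)\<^sup>2 \<le> 9 * (norm w)\<^sup>2 / n\<^sup>2"
      using n by (simp add: r1 field_simps power_mult_distrib power2_eq_square)
    then have "K * (r - 1)\<^sup>2 \<le> K * (9 * (norm w)\<^sup>2 / n\<^sup>2)"
      using K by (rule mult_left_mono)
    then have "r powr q \<le> 1 + q * (b / n\<^sup>2) + K * (9 * (norm w)\<^sup>2 / n\<^sup>2)"
      using powr_second_order_le[of q r 4] q r4 by (simp add: K_def r1)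
    then have "n powr p * r powr q \<le> n powr p * (1 + q * (b / n\<^sup>2) + K * (9 * (norm w)\<^sup>2 / n\<^sup>2))"
      by (rule mult_left_mono) simp
    also have "\<dots> = n powr p + n powr (p - 2) * (q * b + 9 * K * (norm w)\<^sup>2)"
      using n by (simp add: powr_diff field_simps)
    also have "\<dots> = n powr p + p * n powr (p - 2) * (x \<bullet> w)
        + (q + 9 * K) * (n powr (p - 2) * (norm w)\<^sup>2)"
      by (simp add: b_def q(2) algebra_simps)
    also have "\<dots> \<le> n powr p + p * n powr (p - 2) * (x \<bullet> w)
        + C * (n powr (p - 2) * (norm w)\<^sup>2 + norm w powr p)"
      using C q K by (intro add_left_mono mult_mono) auto
    also have "n powr p * r powr q = norm (x + w) powr p"
    proof -
      have "z\<^sup>2 powr q = z powr p" if "0 \<le> z" for z :: real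
        using that by (cases "z = 0") (auto simp: q(2) powr_powr simp flip: powr_numeral)
      then show ?thesis using n by (simp add: r_def powr_divide)
    qed
    finally show ?thesis by (simp add: n_def)
  qed
  then show ?thesis using C by blast
qed

text \<open>Young's inequality with a weight, by comparing \<open>N * b\<^sup>2\<close> with
  \<open>a\<^sup>2\<close>: in either case one summand on the right already suffices.\<close>

lemma powr_diff_two_mult_square_le:
  fixes a b p N :: real
  assumes "0 \<le> a" "0 \<le> b" "2 \<le> p" "0 < N"
  shows "a powr (p - 2) * b\<^sup>2 \<le> a powr p / N + N powr (p / 2 - 1) * b powr p"
proof (cases "N * b\<^sup>2 \<le> a\<^sup>2")
  case True
  then have "b\<^sup>2 \<le> a\<^sup>2 / N" using assms by (simp add: field_simps)
  then have "a powr (p - 2) * b\<^sup>2 \<le> a powr (p - 2) * (a\<^sup>2 / N)"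
    by (rule mult_left_mono) simp
  also have "\<dots> = a powr p / N" using assms by (simp add: powr_diff_two_mult_square)
  finally show ?thesis using assms by (simp add: add_increasing2)
next
  case False
  then have "a \<le> sqrt (N * b\<^sup>2)" by (intro real_le_rsqrt) simp
  also have "\<dots> = N powr (1/2) * b" using assms by (simp add: real_sqrt_mult powr_half_sqrt)
  finally have "a powr (p - 2) \<le> (N powr (1/2) * b) powr (p - 2)"
    using assms by (intro powr_mono2) auto
  also have "\<dots> = N powr (p / 2 - 1) * b powr (p - 2)"
    using assms by (simp add: powr_mult powr_powr diff_divide_distrib)
  finally have "a powr (p - 2) * b\<^sup>2 \<le> N powr (p / 2 - 1) * b powr (p - 2) * b\<^sup>2"
    by (rule mult_right_mono) simp
  also have "\<dots> = N powr (p / 2 - 1) * b powr p"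
    using assms by (simp add: powr_diff_two_mult_square mult.assoc)
  finally show ?thesis using assms by (simp add: add_increasing)
qed

text \<open>
  In the scheme, \<open>x\<close> is the error at the start of a step of size \<open>h\<close>, \<open>y\<close> the centred quadrature
  error, \<open>z\<close> the Lipschitz perturbation and \<open>G\<close> the variation of the solution. The power of \<open>h\<close>
  in front of \<open>y\<close> is Young's inequality with weight \<open>1 / h\<close>, the order of the number of steps.
\<close>

lemma ex_euler_step_powr_le:
  fixes p :: real
  assumes "2 \<le> p"
  shows "\<exists>C\<ge>0. \<forall>(x :: 'a::real_inner) y z h l G.
    0 < h \<longrightarrow> h \<le> 1 \<longrightarrow> 0 \<le> l \<longrightarrow> 0 \<le> G \<longrightarrow> norm z \<le> h * l * (G + norm x) \<longrightarrow>
    norm (x + (y + z)) powr p \<le> norm x powr p + p * norm x powr (p - 2) * (x \<bullet> y)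
      + C * (h * (1 + l powr p) * (norm x powr p + G powr p) + h powr (1 - p / 2) * norm y powr p)"
proof -
  obtain B where B: "1 \<le> B" and exp: "\<And>x w :: 'a.
      norm (x + w) powr p \<le> norm x powr p + p * norm x powr (p - 2) * (x \<bullet> w)
      + B * (norm x powr (p - 2) * (norm w)\<^sup>2 + norm w powr p)"
    using ex_norm_powr_add_le[OF assms, where 'a='a] by blast
  \<comment> \<open>Here \<open>2 * p\<close> pays for the cross term with \<open>z\<close>,
    \<open>B\<close> for \<open>h * n powr p \<le> Q\<close>, and the last summand for
    \<open>norm (y + z) powr p\<close>, which occurs twice: directly and through Young's
    inequality.\<close>
  define C where "C = 2 * p + B + 2 * B * 2 powr p * (1 + 2 powr p)"
  have C0: "0 \<le> C" using B assms by (simp add: C_def)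
  have "norm (x + (y + z)) powr p \<le> norm x powr p + p * norm x powr (p - 2) * (x \<bullet> y)
      + C * (h * (1 + l powr p) * (norm x powr p + G powr p) + h powr (1 - p / 2) * norm y powr p)"
    if h: "0 < h" "h \<le> 1" and l: "0 \<le> l" and G: "0 \<le> G" and z: "norm z \<le> h * l * (G + norm x)"
    for x y z :: 'a and h l G :: real
  proof -
    define n where "n = norm x"
    define Q where "Q = h * (1 + l powr p) * (n powr p + G powr p)"
    define R where "R = h powr (1 - p / 2) * norm y powr p"
    have n0: "0 \<le> n" by (simp add: n_def)
    have QR: "0 \<le> Q" "0 \<le> R" using h by (auto simp: Q_def R_def)
    have hnp: "h * n powr p \<le> Q"
      using h by (simp add: Q_def algebra_simps add_increasing add_increasing2)
    have h_neg: "1 \<le> h powr (1 - p / 2)"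
      using h assms powr_mono'[of "1 - p / 2" 0 h] by simp
    have "l \<le> 1 + l powr p" using powr_pred_mult_le[of 1 l p] l assms by simp
    have "n powr (p - 2) * (x \<bullet> z) \<le> n powr (p - 2) * (n * norm z)"
      using Cauchy_Schwarz_ineq2[of x z] by (intro mult_left_mono) (auto simp: n_def)
    also have "\<dots> = n powr (p - 1) * norm z"
      using n0 by (cases "n = 0") (auto simp: powr_diff power2_eq_square)
    also have "\<dots> \<le> n powr (p - 1) * (h * l * (G + n))"
      using z by (intro mult_left_mono) (auto simp: n_def)
    also have "\<dots> = h * l * (n powr (p - 1) * G + n powr (p - 1) * n)"
      by (simp add: algebra_simps)
    also have "\<dots> \<le> h * (1 + l powr p) * ((n powr p + G powr p) + n powr p)"
    proof (rule mult_mono)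
      show "h * l \<le> h * (1 + l powr p)" using \<open>l \<le> 1 + l powr p\<close> h by simp
      have "n powr (p - 1) * n = n powr p"
        using n0 by (cases "n = 0") (auto simp: powr_diff)
      then show "n powr (p - 1) * G + n powr (p - 1) * n \<le> (n powr p + G powr p) + n powr p"
        using powr_pred_mult_le[of n G p] n0 G assms by simp
    qed (use h n0 G l in auto)
    also have "\<dots> \<le> h * (1 + l powr p) * (2 * (n powr p + G powr p))"
      using h by (intro mult_left_mono) auto
    also have "\<dots> = 2 * Q" by (simp add: Q_def)
    finally have xz: "n powr (p - 2) * (x \<bullet> z) \<le> 2 * Q" .
    \<comment> \<open>As \<open>z\<close> is of order \<open>h\<close>, its \<open>p\<close>-th
      power times the weight \<open>h powr (1 - p / 2)\<close> still carries
      \<open>h powr (1 + p / 2)\<close>, which is at most \<open>h\<close>.\<close>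
    have "norm z powr p \<le> (h * l * (G + n)) powr p"
      using z assms by (intro powr_mono2) (auto simp: n_def)
    also have "\<dots> = h powr p * l powr p * (G + n) powr p"
      using h l G n0 by (simp add: powr_mult)
    also have "\<dots> \<le> h powr p * (1 + l powr p) * (2 powr p * (G powr p + n powr p))"
      using assms G n0 by (intro mult_mono powr_add_le) auto
    finally have "h powr (1 - p / 2) * norm z powr p
        \<le> h powr (1 - p / 2) * (h powr p * (1 + l powr p) * (2 powr p * (G powr p + n powr p)))"
      by (rule mult_left_mono) simp
    also have "\<dots> = h powr (1 + p / 2) * ((1 + l powr p) * (2 powr p * (G powr p + n powr p)))"
    proof -
      have "h powr (1 - p / 2) * h powr p = h powr (1 + p / 2)"
        unfolding powr_add[symmetric] by (rule arg_cong[where f = "(powr) h"]) simp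
      then show ?thesis by (simp only: mult.assoc[symmetric])
    qed
    also have "\<dots> \<le> h * ((1 + l powr p) * (2 powr p * (G powr p + n powr p)))"
    proof (rule mult_right_mono)
      show "h powr (1 + p / 2) \<le> h" using powr_mono'[of 1 "1 + p / 2" h] h assms by simp
    qed simp
    also have "\<dots> = 2 powr p * Q" by (simp add: Q_def algebra_simps)
    finally have zp: "h powr (1 - p / 2) * norm z powr p \<le> 2 powr p * Q" .
    have "norm (y + z) powr p \<le> (norm y + norm z) powr p"
      using assms by (intro powr_mono2 norm_triangle_ineq) auto
    also have "\<dots> \<le> 2 powr p * (norm y powr p + norm z powr p)"
      using assms by (intro powr_add_le) auto
    finally have "h powr (1 - p / 2) * norm (y + z) powr p
        \<le> h powr (1 - p / 2) * (2 powr p * (norm y powr p + norm z powr p))"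
      by (rule mult_left_mono) simp
    also have "\<dots> = 2 powr p * (R + h powr (1 - p / 2) * norm z powr p)"
      by (simp add: R_def algebra_simps)
    also have "\<dots> \<le> 2 powr p * (R + 2 powr p * Q)"
      using zp by (intro mult_left_mono add_left_mono) auto
    also have "\<dots> \<le> 2 powr p * (1 + 2 powr p) * (Q + R)"
      using QR by (simp add: algebra_simps)
    finally have w: "h powr (1 - p / 2) * norm (y + z) powr p \<le> 2 powr p * (1 + 2 powr p) * (Q + R)" .
    have "n powr (p - 2) * (norm (y + z))\<^sup>2 + norm (y + z) powr p
        \<le> (h * n powr p + h powr (1 - p / 2) * norm (y + z) powr p)
          + h powr (1 - p / 2) * norm (y + z) powr p"
    proof (rule add_mono)
      show "n powr (p - 2) * (norm (y + z))\<^sup>2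
          \<le> h * n powr p + h powr (1 - p / 2) * norm (y + z) powr p"
      proof -
        have "(1 / h) powr (p / 2 - 1) = h powr (1 - p / 2)"
          using powr_minus_divide[of h "p / 2 - 1"] h by (simp add: powr_divide)
        then show ?thesis
          using powr_diff_two_mult_square_le[of n "norm (y + z)" p "1 / h"] assms h n0
          by (simp add: mult.commute)
      qed
      show "norm (y + z) powr p \<le> h powr (1 - p / 2) * norm (y + z) powr p"
        using h_neg mult_right_mono[of 1 _ "norm (y + z) powr p"] by simp
    qed
    also have "\<dots> \<le> Q + 2 * (2 powr p * (1 + 2 powr p) * (Q + R))"
      using hnp w by linarith
    finally have "B * (n powr (p - 2) * (norm (y + z))\<^sup>2 + norm (y + z) powr p)
        \<le> B * (Q + 2 * (2 powr p * (1 + 2 powr p) * (Q + R)))"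
      using B by (intro mult_left_mono) auto
    moreover have "p * (n powr (p - 2) * (x \<bullet> z)) \<le> p * (2 * Q)"
      using xz assms by (intro mult_left_mono) auto
    moreover have "p * (2 * Q) + B * (Q + 2 * (2 powr p * (1 + 2 powr p) * (Q + R))) \<le> C * (Q + R)"
    proof -
      have "0 \<le> (2 * p + B) * R" using QR B assms by (intro mult_nonneg_nonneg) auto
      then show ?thesis unfolding C_def by (simp add: algebra_simps)
    qed
    ultimately have "norm (x + (y + z)) powr p
        \<le> n powr p + p * n powr (p - 2) * (x \<bullet> y) + C * (Q + R)"
      using exp[of x "y + z"] by (simp add: inner_add_right algebra_simps flip: n_def)
    then show ?thesis by (simp only: n_def Q_def R_def)
  qed
  with C0 show ?thesis by blast
qed

section \<open>Moments of one random step\<close>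

text \<open>Integrating the pointwise step bound, the term linear in \<open>Y\<close> vanishes
  because \<open>Y\<close> is centred. The point \<open>x\<close> is deterministic here;
  independence later allows a random error in its place.\<close>

lemma (in prob_space) nn_integral_euler_step_le:
  fixes Y Z :: "'a \<Rightarrow> 'b::euclidean_space" and l :: "'a \<Rightarrow> real" and p h C G :: real
  assumes C: "\<And>(x :: 'b) y z l G. norm z \<le> h * l * (G + norm x) \<Longrightarrow> 0 \<le> l \<Longrightarrow> 0 \<le> G \<Longrightarrow>
      norm (x + (y + z)) powr p \<le> norm x powr p + p * norm x powr (p - 2) * (x \<bullet> y)
      + C * (h * (1 + l powr p) * (norm x powr p + G powr p) + h powr (1 - p / 2) * norm y powr p)"
    and Y: "integrable M Y" "expectation Y = 0" "integrable M (\<lambda>\<omega>. norm (Y \<omega>) powr p)"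
    and l: "\<And>\<omega>. 0 \<le> l \<omega>" "integrable M (\<lambda>\<omega>. l \<omega> powr p)"
    and G: "0 \<le> G"
    and Z: "AE \<omega> in M. norm (Z \<omega>) \<le> h * l \<omega> * (G + norm x)"
  shows "(\<integral>\<^sup>+\<omega>. ennreal (norm (x + (Y \<omega> + Z \<omega>)) powr p) \<partial>M) \<le>
    ennreal (norm x powr p + C * (h * (1 + expectation (\<lambda>\<omega>. l \<omega> powr p)) * (norm x powr p + G powr p)
      + h powr (1 - p / 2) * expectation (\<lambda>\<omega>. norm (Y \<omega>) powr p)))"
proof -
  define B where "B \<omega> = norm x powr p + p * norm x powr (p - 2) * (x \<bullet> Y \<omega>)
      + C * (h * (1 + l \<omega> powr p) * (norm x powr p + G powr p)
      + h powr (1 - p / 2) * norm (Y \<omega>) powr p)" for \<omega>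
  have le: "AE \<omega> in M. norm (x + (Y \<omega> + Z \<omega>)) powr p \<le> B \<omega>"
    using Z unfolding B_def by (rule AE_mp) (intro AE_I2 impI C l G)
  have int: "integrable M B" unfolding B_def
    using Y l by (intro Bochner_Integration.integrable_add integrable_mult_right integrable_mult_left
        integrable_inner_right) auto
  have "(\<integral>\<^sup>+\<omega>. ennreal (norm (x + (Y \<omega> + Z \<omega>)) powr p) \<partial>M) \<le> (\<integral>\<^sup>+\<omega>. ennreal (B \<omega>) \<partial>M)"
    using le by (intro nn_integral_mono_AE) (auto intro: ennreal_leI)
  \<comment> \<open>The majorant contains a signed inner product, but is nonnegative almost
    everywhere because it dominates a power.\<close>
  also have "\<dots> = ennreal (expectation B)"
    using le by (intro nn_integral_eq_integral int) (auto elim!: eventually_mono intro: order_trans[OF powr_ge_zero])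
  also have "expectation B = norm x powr p + C * (h * (1 + expectation (\<lambda>\<omega>. l \<omega> powr p)) * (norm x powr p + G powr p)
      + h powr (1 - p / 2) * expectation (\<lambda>\<omega>. norm (Y \<omega>) powr p))"
    unfolding B_def using Y l by (simp add: prob_space)
  finally show ?thesis .
qed

text \<open>Jensen's inequality, by integrating the tangent line at the mean.\<close>

lemma (in prob_space) expectation_powr_le:
  fixes X :: "'a \<Rightarrow> real"
  assumes "1 \<le> p" "\<And>\<omega>. 0 \<le> X \<omega>" "integrable M X" "integrable M (\<lambda>\<omega>. X \<omega> powr p)"
  shows "expectation X powr p \<le> expectation (\<lambda>\<omega>. X \<omega> powr p)"
proof -
  define c where "c = expectation X"
  have "0 \<le> c" using assms by (simp add: c_def)
  then have "(\<integral>\<omega>. c powr p + p * c powr (p - 1) * (X \<omega> - c) \<partial>M) \<le> (\<integral>\<omega>. X \<omega> powr p \<partial>M)"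
    using assms by (intro integral_mono powr_above_tangent) auto
  then show ?thesis using assms by (simp add: c_def prob_space)
qed

text \<open>Independence makes the joint law a product, and Fubini applies. The inner integral is
  the conditional expectation with the value of \<open>X\<close> frozen.\<close>

lemma (in prob_space) nn_integral_indep_var:
  assumes "indep_var S X N Y" "\<phi> \<in> borel_measurable (S \<Otimes>\<^sub>M N)"
  shows "(\<integral>\<^sup>+\<omega>. \<phi> (X \<omega>, Y \<omega>) \<partial>M) = (\<integral>\<^sup>+\<omega>. (\<integral>\<^sup>+\<omega>'. \<phi> (X \<omega>, Y \<omega>') \<partial>M) \<partial>M)"
proof -
  have [measurable]: "random_variable S X" "random_variable N Y"
    and eq: "distr M S X \<Otimes>\<^sub>M distr M N Y = distr M (S \<Otimes>\<^sub>M N) (\<lambda>\<omega>. (X \<omega>, Y \<omega>))"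
    using assms(1) unfolding indep_var_distribution_eq by auto
  interpret Y: prob_space "distr M N Y" by (rule prob_space_distr) simp
  note assms(2)[measurable]
  have "(\<integral>\<^sup>+\<omega>. \<phi> (X \<omega>, Y \<omega>) \<partial>M) = (\<integral>\<^sup>+z. \<phi> z \<partial>(distr M S X \<Otimes>\<^sub>M distr M N Y))"
    by (simp add: eq nn_integral_distr)
  also have "\<dots> = (\<integral>\<^sup>+x. (\<integral>\<^sup>+y. \<phi> (x, y) \<partial>distr M N Y) \<partial>distr M S X)"
    by (rule Y.nn_integral_fst[symmetric]) simp
  also have "\<dots> = (\<integral>\<^sup>+\<omega>. (\<integral>\<^sup>+y. \<phi> (X \<omega>, y) \<partial>distr M N Y) \<partial>M)"
    by (subst nn_integral_distr) auto
  also have "\<dots> = (\<integral>\<^sup>+\<omega>. (\<integral>\<^sup>+\<omega>'. \<phi> (X \<omega>, Y \<omega>') \<partial>M) \<partial>M)"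
    by (intro nn_integral_cong nn_integral_distr) (auto simp: measurable_space)
  finally show ?thesis .
qed

section \<open>Uniform random nodes in a grid cell\<close>

abbreviation (input) unif :: "real measure" where "unif \<equiv> uniform_measure lborel {0<..<1}"

lemma prob_space_unif: "prob_space unif"
  by (rule prob_space_uniform_measure) auto

text \<open>Affine changes of variable preserve null sets, so a condition valid at almost every time
  is valid at almost every random node.\<close>

lemma AE_unif_affine:
  assumes "AE r in lborel. P r" "0 < h"
  shows "AE s in unif. P (t + s * h)"
proof -
  obtain N where N: "N \<in> sets borel" "AE r in lborel. r \<notin> N" "{r. \<not> P r} \<subseteq> N"
    using assms(1) unfolding eventually_ae_filter
    by (auto simp: null_sets_def intro: AE_not_in)
  have "AE s in lborel. t + h * s \<notin> N"
    using N assms by (intro AE_borel_affine) auto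
  then have "AE s in lborel. P (t + s * h)"
    by (rule eventually_mono) (use N(3) in \<open>auto simp: mult.commute\<close>)
  then show ?thesis by (intro AE_uniform_measureI) auto
qed

text \<open>The substitution \<open>r = t + s * h\<close> carries the uniform law to normalized
  Lebesgue measure on the cell; this makes the one-point quadrature unbiased.\<close>

lemma unif_affine:
  fixes \<phi> :: "real \<Rightarrow> 'b::{banach, second_countable_topology}"
  assumes \<phi>: "integrable lborel \<phi>" and h: "0 < h"
  shows integrable_unif_affine: "integrable unif (\<lambda>s. \<phi> (t + s * h))"
    and integral_unif_affine:
      "h *\<^sub>R (LINT s|unif. \<phi> (t + s * h)) = (LINT r:{t<..<t + h}|lborel. \<phi> r)"
proof -
  have unif: "unif = density lborel (\<lambda>s. ennreal (indicator {0<..<1} s))"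
    unfolding uniform_measure_def by (intro density_cong) (auto simp: indicator_def)
  have [measurable]: "\<phi> \<in> borel_measurable borel" using \<phi> by auto
  have int: "integrable lborel (\<lambda>r. indicat_real {t<..<t + h} r *\<^sub>R \<phi> r)"
    using \<phi> by (intro integrable_mult_indicator) auto
  have ind: "indicat_real {t<..<t + h} (t + s * h) = indicat_real {0<..<1} s" for s
    using h by (auto simp: indicator_def field_simps zero_less_mult_iff)
  have "integrable lborel (\<lambda>s. indicat_real {0<..<1} s *\<^sub>R \<phi> (t + s * h))"
    using lborel_integrable_real_affine[OF int, of h t] h by (simp add: ind mult.commute)
  then show "integrable unif (\<lambda>s. \<phi> (t + s * h))"
    by (simp add: unif integrable_density)
  show "h *\<^sub>R (LINT s|unif. \<phi> (t + s * h)) = (LINT r:{t<..<t + h}|lborel. \<phi> r)"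
    unfolding set_lebesgue_integral_def unif
    using lborel_integral_real_affine[of h "\<lambda>r. indicat_real {t<..<t + h} r *\<^sub>R \<phi> r" t] h
    by (simp add: ind mult.commute integral_density)
qed

lemma sum_Ioo_integral_le:
  fixes \<phi> :: "real \<Rightarrow> real"
  assumes \<phi>: "integrable lborel \<phi>" "\<And>r. 0 \<le> \<phi> r" and h: "0 \<le> h"
  shows "(\<Sum>k<n. LINT r:{real k * h<..<real k * h + h}|lborel. \<phi> r) \<le> (LINT r|lborel. \<phi> r)"
proof -
  have s: "set_integrable lborel A \<phi>" if "A \<in> sets borel" for A
    using \<phi> that unfolding set_integrable_def by (intro integrable_mult_indicator) auto
  have mono: "(LINT r:A|lborel. \<phi> r) \<le> (LINT r:B|lborel. \<phi> r)"
    if "A \<subseteq> B" "A \<in> sets borel" "B \<in> sets borel" for A B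
    unfolding set_lebesgue_integral_def
    by (rule integral_mono[OF s[unfolded set_integrable_def] s[unfolded set_integrable_def]])
       (use that \<phi> in \<open>auto simp: indicator_def\<close>)
  \<comment> \<open>Half-open cells tile the interval exactly, which gives the induction an additive
    right-hand side.\<close>
  have "(\<Sum>k<n. LINT r:{real k * h<..<real k * h + h}|lborel. \<phi> r)
      \<le> (LINT r:{0<..real n * h}|lborel. \<phi> r)"
  proof (induction n)
    case (Suc n)
    have "(LINT r:{real n * h<..<real n * h + h}|lborel. \<phi> r)
        \<le> (LINT r:{real n * h<..real n * h + h}|lborel. \<phi> r)"
      by (intro mono) auto
    moreover have "(LINT r:{0<..real (Suc n) * h}|lborel. \<phi> r)
        = (LINT r:{0<..real n * h}|lborel. \<phi> r) + (LINT r:{real n * h<..real n * h + h}|lborel. \<phi> r)"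
    proof -
      have "{0<..real (Suc n) * h} = {0<..real n * h} \<union> {real n * h<..real n * h + h}"
        using h by (auto simp: algebra_simps) (smt (verit) mult_nonneg_nonneg of_nat_0_le_iff)+
      then show ?thesis using s by (simp add: set_integral_Un)
    qed
    ultimately show ?case using Suc by simp
  qed (simp add: set_lebesgue_integral_def)
  also have "\<dots> \<le> (LINT r|lborel. \<phi> r)"
    using mono[of "{0<..real n * h}" UNIV] by (simp add: set_lebesgue_integral_def)
  finally show ?thesis .
qed

text \<open>The Borel--Cantelli lemma, with the last exceptional index turned into a measurable
  random variable.\<close>

lemma (in prob_space) ex_random_index_eventually:
  assumes [measurable]: "\<And>m. E m \<in> events" and "summable (\<lambda>m. prob (E m))"
  shows "\<exists>(m0 :: 'a \<Rightarrow> nat) A. m0 \<in> measurable M (count_space UNIV) \<and> A \<in> events \<and> prob A = 1 \<and>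
    (\<forall>\<omega>\<in>A. \<forall>m\<ge>m0 \<omega>. \<omega> \<notin> E m)"
proof -
  define A where "A = {\<omega>\<in>space M. \<exists>k. \<forall>m\<ge>k. \<omega> \<notin> E m}"
  \<comment> \<open>Off \<open>A\<close> no index qualifies and \<open>LEAST\<close> has an
    unspecified value; only measurability matters there.\<close>
  define m0 where "m0 \<omega> = (LEAST k. \<forall>m\<ge>k. \<omega> \<notin> E m)" for \<omega>
  have m0: "m0 \<in> measurable M (count_space UNIV)" unfolding m0_def by measurable
  have A: "A \<in> events" unfolding A_def by measurable
  have "AE \<omega> in M. eventually (\<lambda>m. \<omega> \<in> space M - E m) sequentially"
    by (rule borel_cantelli_AE1) (use assms in \<open>auto simp: emeasure_eq_measure\<close>)
  then have "AE \<omega> in M. \<omega> \<in> A"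
    by (rule AE_mp) (intro AE_I2 impI, auto simp: A_def eventually_sequentially)
  then have pA: "prob A = 1" using A by (simp add: prob_eq_1)
  have "\<forall>m\<ge>m0 \<omega>. \<omega> \<notin> E m" if "\<omega> \<in> A" for \<omega>
    unfolding m0_def by (rule LeastI_ex) (use that in \<open>simp add: A_def\<close>)
  with m0 A pA show ?thesis by blast
qed

section \<open>The error recursion\<close>

lemma set_integrable_of_integrable:
  fixes \<phi> :: "real \<Rightarrow> 'b::{banach, second_countable_topology}"
  assumes "integrable lborel \<phi>" "A \<in> sets borel"
  shows "set_integrable lborel A \<phi>"
  using assms unfolding set_integrable_def by (intro integrable_mult_indicator) auto

lemma set_integral_nonneg_real: "(\<And>r. 0 \<le> \<phi> r) \<Longrightarrow> 0 \<le> (LINT r:A|lborel. \<phi> r :: real)"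
  unfolding set_lebesgue_integral_def by (intro integral_nonneg_AE) auto

text \<open>The hypotheses are posed on the whole line, to be met by data extended by zero outside
  \<open>[0, T]\<close>. The growth bound enters as \<open>p\<close>-integrability of the right-hand
  side along \<open>u\<close>.\<close>

locale caratheodory_ivp =
  fixes T p :: real and f :: "real \<Rightarrow> 'a::euclidean_space \<Rightarrow> 'a"
    and L :: "real \<Rightarrow> real" and u :: "real \<Rightarrow> 'a" and u0 :: 'a
  assumes T_pos: "0 < T" and p_ge_2: "2 \<le> p"
    and f_measurable: "(\<lambda>(t, x). f t x) \<in> borel_measurable (borel \<Otimes>\<^sub>M borel)"
    and L_nonneg: "\<And>t. 0 \<le> L t"
    and L_integrable: "integrable lborel (\<lambda>t. L t powr p)"
    and lipschitz: "AE t in lborel. \<forall>x y. norm (f t x - f t y) \<le> L t * norm (x - y)"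
    and rhs_integrable: "integrable lborel (\<lambda>t. f t (u t))"
    and rhs_powr_integrable: "integrable lborel (\<lambda>t. norm (f t (u t)) powr p)"
    and solution: "\<And>t. t \<in> {0..T} \<Longrightarrow> u t = u0 + (LINT s:{0..t}|lborel. f s (u s))"
begin

definition g :: "real \<Rightarrow> 'a" where "g t = f t (u t)"

lemma g_integrable: "integrable lborel g" "integrable lborel (\<lambda>t. norm (g t))"
    "integrable lborel (\<lambda>t. norm (g t) powr p)"
  using rhs_integrable rhs_powr_integrable by (auto simp: g_def [abs_def])

text \<open>Single points are null, so the increment can be written over the open cell, matching
  \<open>integral_unif_affine\<close>.\<close>

lemma solution_increment:
  assumes "0 \<le> a" "a \<le> b" "b \<le> T"
  shows "u b - u a = (LINT s:{a<..<b}|lborel. g s)"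
proof -
  have "{0..b} = {0..a} \<union> {a<..b}" using assms by auto
  then have "(LINT s:{0..b}|lborel. g s) = (LINT s:{0..a}|lborel. g s) + (LINT s:{a<..b}|lborel. g s)"
    using g_integrable(1) by (auto intro!: set_integral_Un set_integrable_of_integrable)
  moreover have "(LINT s:{a<..b}|lborel. g s) = (LINT s:{a<..<b}|lborel. g s)"
    unfolding set_lebesgue_integral_def
    using g_integrable(1) AE_lborel_singleton[of b]
    by (intro integral_cong_AE) (auto simp: indicator_def elim!: eventually_mono)
  ultimately show ?thesis using assms by (simp add: solution g_def)
qed

text \<open>In the application \<open>b\<close> is a random node and \<open>c\<close> the end of its
  cell, so one bound serves all nodes of the cell.\<close>

lemma norm_solution_increment_le:
  assumes "0 \<le> a" "a \<le> b" "b \<le> c" "c \<le> T"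
  shows "norm (u b - u a) \<le> (LINT s:{a<..<c}|lborel. norm (g s))"
proof -
  have "norm (u b - u a) \<le> (LINT s:{a<..<b}|lborel. norm (g s))"
    using assms g_integrable(1)
    by (auto simp: solution_increment intro!: set_integral_norm_bound set_integrable_of_integrable)
  also have "\<dots> \<le> (LINT s:{a<..<c}|lborel. norm (g s))"
    using set_integrable_of_integrable[OF g_integrable(2), of "{a<..<b}"]
      set_integrable_of_integrable[OF g_integrable(2), of "{a<..<c}"] assms
    unfolding set_lebesgue_integral_def set_integrable_def
    by (intro integral_mono) (auto simp: indicator_def)
  finally show ?thesis .
qed

text \<open>Here \<open>x\<close> stands for exact minus numerical value at time
  \<open>k * h\<close>, so \<open>u (real k * h) - x\<close> is the numerical value;
  \<open>s\<close> is the fresh random node.\<close>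

definition error_step :: "real \<Rightarrow> nat \<Rightarrow> 'a \<Rightarrow> real \<Rightarrow> 'a" where
  "error_step h k x s = x + (u (real (Suc k) * h) - u (real k * h)
     - h *\<^sub>R f (real k * h + s * h) (u (real k * h) - x))"

lemma error_step_measurable:
  "(\<lambda>(x, s). error_step h k x s) \<in> borel_measurable (borel \<Otimes>\<^sub>M borel)"
proof -
  have "(\<lambda>z. (real k * h + snd z * h, u (real k * h) - fst z))
      \<in> (borel \<Otimes>\<^sub>M borel) \<rightarrow>\<^sub>M (borel \<Otimes>\<^sub>M (borel :: 'a measure))"
    by measurable
  from measurable_compose[OF this f_measurable]
  have [measurable]: "(\<lambda>z. f (real k * h + snd z * h) (u (real k * h) - fst z))
      \<in> borel_measurable (borel \<Otimes>\<^sub>M borel)" by simp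
  show ?thesis unfolding error_step_def case_prod_beta by measurable
qed

text \<open>
  With \<open>e k\<close> the \<open>p\<close>-th moment of the error after \<open>k\<close> steps, the recursion reads
  \<open>e (Suc k) \<le> (1 + C * \<Lambda> h k) * e k + C' * h powr (p / 2) * \<gamma> h k\<close>;
  both weights have sums bounded independently of \<open>h\<close>.
\<close>

definition \<Lambda> :: "real \<Rightarrow> nat \<Rightarrow> real" where
  "\<Lambda> h k = h + (LINT r:{real k * h<..<real k * h + h}|lborel. L r powr p)"

definition \<gamma> :: "real \<Rightarrow> nat \<Rightarrow> real" where
  "\<gamma> h k = (LINT r:{real k * h<..<real k * h + h}|lborel. norm (g r) powr p)"

lemma \<Lambda>_nonneg: "0 \<le> h \<Longrightarrow> 0 \<le> \<Lambda> h k" and \<gamma>_nonneg: "0 \<le> \<gamma> h k"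
  by (auto simp: \<Lambda>_def \<gamma>_def intro!: add_nonneg_nonneg set_integral_nonneg_real)

lemma sum_\<Lambda>_le:
  assumes "0 \<le> h" "real n * h \<le> T"
  shows "(\<Sum>k<n. \<Lambda> h k) \<le> T + (LINT r|lborel. L r powr p)"
  using sum_Ioo_integral_le[OF L_integrable, of h n] assms
  by (simp add: \<Lambda>_def sum.distrib)

lemma sum_\<gamma>_le:
  assumes "0 \<le> h"
  shows "(\<Sum>k<n. \<gamma> h k) \<le> (LINT r|lborel. norm (g r) powr p)"
  unfolding \<gamma>_def using assms g_integrable(3) by (intro sum_Ioo_integral_le) auto

text \<open>The step is split into the centred quadrature error \<open>Y\<close> and the Lipschitz
  perturbation \<open>Z\<close>. Jensen's inequality turns both \<open>G powr p\<close> and the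
  \<open>p\<close>-th moment of \<open>Y\<close> into multiples of
  \<open>h powr (p - 1) * \<gamma> h k\<close>.\<close>

lemma error_step_moment_le:
  fixes C h :: real
  assumes C0: "0 \<le> C" and C: "\<And>(x :: 'a) y z l G. norm z \<le> h * l * (G + norm x) \<Longrightarrow> 0 \<le> l \<Longrightarrow> 0 \<le> G \<Longrightarrow>
      norm (x + (y + z)) powr p \<le> norm x powr p + p * norm x powr (p - 2) * (x \<bullet> y)
      + C * (h * (1 + l powr p) * (norm x powr p + G powr p) + h powr (1 - p / 2) * norm y powr p)"
    and h: "0 < h" "h \<le> 1" "real (Suc k) * h \<le> T"
  shows "(\<integral>\<^sup>+s. ennreal (norm (error_step h k x s) powr p) \<partial>unif)
    \<le> ennreal ((1 + C * \<Lambda> h k) * norm x powr p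
        + C * (T + (LINT r|lborel. L r powr p) + 2 * 2 powr p) * h powr (p / 2) * \<gamma> h k)"
proof -
  interpret unif: prob_space unif by (rule prob_space_unif)
  define t where "t = real k * h"
  have t: "0 \<le> t" "t + h \<le> T" "real (Suc k) * h = t + h"
    using h by (auto simp: t_def algebra_simps)
  define G where "G = (LINT s:{t<..<t + h}|lborel. norm (g s))"
  define Y where "Y s = u (t + h) - u t - h *\<^sub>R g (t + s * h)" for s
  define Z where "Z s = h *\<^sub>R (g (t + s * h) - f (t + s * h) (u t - x))" for s
  define A where "A = T + (LINT r|lborel. L r powr p)"
  note gi = g_integrable[THEN integrable_unif_affine, OF h(1), of t]
  have G0: "0 \<le> G" by (simp add: G_def set_integral_nonneg_real)
  have gE: "h * unif.expectation (\<lambda>s. norm (g (t + s * h)) powr p) = \<gamma> h k"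
    using integral_unif_affine[OF g_integrable(3) h(1), of t] by (simp add: \<gamma>_def t_def)
  have LE: "h * (1 + unif.expectation (\<lambda>s. L (t + s * h) powr p)) = \<Lambda> h k"
    using integral_unif_affine[OF L_integrable h(1), of t] by (simp add: \<Lambda>_def t_def algebra_simps)
  \<comment> \<open>A single weight is bounded by the sum of all weights; this moves
    \<open>\<Lambda> h k * G powr p\<close> into the inhomogeneous term.\<close>
  have "\<Lambda> h k \<le> (\<Sum>i<Suc k. \<Lambda> h i)"
    using \<Lambda>_nonneg h by (simp add: sum_nonneg)
  also have "\<dots> \<le> A" unfolding A_def using h by (intro sum_\<Lambda>_le) auto
  finally have \<Lambda>_le: "\<Lambda> h k \<le> A" .
  have G_eq: "G = h * unif.expectation (\<lambda>s. norm (g (t + s * h)))"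
    using integral_unif_affine[OF g_integrable(2) h(1), of t] by (simp add: G_def)
  have hp: "h powr p * (\<gamma> h k / h) = h powr (p - 1) * \<gamma> h k"
    using h by (simp add: powr_diff)
  have G_powr: "G powr p \<le> h powr (p - 1) * \<gamma> h k"
  proof -
    have "unif.expectation (\<lambda>s. norm (g (t + s * h))) powr p
        \<le> unif.expectation (\<lambda>s. norm (g (t + s * h)) powr p)"
      using p_ge_2 gi by (intro unif.expectation_powr_le) auto
    then have "G powr p \<le> h powr p * unif.expectation (\<lambda>s. norm (g (t + s * h)) powr p)"
      using h by (simp add: G_eq powr_mult mult_left_mono)
    also have "unif.expectation (\<lambda>s. norm (g (t + s * h)) powr p) = \<gamma> h k / h"
      using gE h by (simp add: field_simps)
    finally show ?thesis using hp by simp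
  qed
  have Y_int: "integrable unif Y" unfolding Y_def using gi by auto
  have Y_mean: "unif.expectation Y = 0"
  proof -
    have "unif.expectation Y = u (t + h) - u t - h *\<^sub>R unif.expectation (\<lambda>s. g (t + s * h))"
      unfolding Y_def using gi by (simp add: unif.prob_space)
    also have "\<dots> = 0"
      using integral_unif_affine[OF g_integrable(1) h(1), of t] solution_increment[of t "t + h"] t h
      by simp
    finally show ?thesis .
  qed
  have Y_le: "norm (Y s) powr p \<le> 2 powr p * (G powr p + h powr p * norm (g (t + s * h)) powr p)" for s
  proof -
    have "norm (Y s) \<le> norm (u (t + h) - u t) + h * norm (g (t + s * h))"
      unfolding Y_def using norm_triangle_ineq4[of "u (t + h) - u t" "h *\<^sub>R g (t + s * h)"] h by simp
    also have "norm (u (t + h) - u t) \<le> G"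
      unfolding G_def using t h by (intro norm_solution_increment_le) auto
    finally have "norm (Y s) powr p \<le> (G + h * norm (g (t + s * h))) powr p"
      using p_ge_2 by (intro powr_mono2) auto
    also have "\<dots> \<le> 2 powr p * (G powr p + (h * norm (g (t + s * h))) powr p)"
      using p_ge_2 h G0 by (intro powr_add_le) auto
    finally show ?thesis using h by (simp add: powr_mult)
  qed
  have dom_int: "integrable unif (\<lambda>s. 2 powr p * (G powr p + h powr p * norm (g (t + s * h)) powr p))"
    using gi by auto
  have Yp_int: "integrable unif (\<lambda>s. norm (Y s) powr p)"
    using Y_int Y_le by (intro Bochner_Integration.integrable_bound[OF dom_int]) auto
  have "unif.expectation (\<lambda>s. norm (Y s) powr p)
      \<le> unif.expectation (\<lambda>s. 2 powr p * (G powr p + h powr p * norm (g (t + s * h)) powr p))"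
    using Y_le by (intro integral_mono Yp_int dom_int) auto
  also have "\<dots> = 2 powr p * (G powr p + h powr p * (\<gamma> h k / h))"
    using gi gE h by (simp add: unif.prob_space field_simps)
  also have "\<dots> \<le> 2 powr p * (2 * (h powr (p - 1) * \<gamma> h k))"
    using G_powr hp by (intro mult_left_mono) auto
  finally have "h powr (1 - p / 2) * unif.expectation (\<lambda>s. norm (Y s) powr p)
      \<le> h powr (1 - p / 2) * (2 powr p * (2 * (h powr (p - 1) * \<gamma> h k)))"
    by (rule mult_left_mono) simp
  also have "\<dots> = 2 * 2 powr p * ((h powr (1 - p / 2) * h powr (p - 1)) * \<gamma> h k)"
    by (simp add: mult_ac)
  \<comment> \<open>The exponents add up to \<open>p / 2\<close>, which is the order of the
    \<open>p\<close>-th moment of the error.\<close>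
  also have "h powr (1 - p / 2) * h powr (p - 1) = h powr (p / 2)"
    unfolding powr_add[symmetric] by (rule arg_cong[where f = "(powr) h"]) simp
  finally have Y_bound: "h powr (1 - p / 2) * unif.expectation (\<lambda>s. norm (Y s) powr p)
      \<le> 2 * 2 powr p * (h powr (p / 2) * \<gamma> h k)" .
  \<comment> \<open>For \<open>p \<ge> 2\<close> one has \<open>p - 1 \<ge> p / 2\<close>, and
    \<open>h \<le> 1\<close>.\<close>
  have "G powr p \<le> h powr (p / 2) * \<gamma> h k"
    using G_powr by (rule order_trans)
      (use h p_ge_2 \<gamma>_nonneg in \<open>auto intro!: mult_right_mono powr_mono'\<close>)
  then have G_bound: "\<Lambda> h k * G powr p \<le> A * (h powr (p / 2) * \<gamma> h k)"
    using \<Lambda>_le \<Lambda>_nonneg[of h k] h by (intro mult_mono) auto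
  have Z: "AE s in unif. norm (Z s) \<le> h * L (t + s * h) * (G + norm x)"
  proof -
    have "AE s in unif. s \<in> {0<..<1}" by (intro AE_uniform_measureI) auto
    with AE_unif_affine[OF lipschitz h(1), of t] show ?thesis
    proof eventually_elim
      case (elim s)
      have "s * h \<le> h" using elim h by simp
      have "norm (Z s) = h * norm (f (t + s * h) (u (t + s * h)) - f (t + s * h) (u t - x))"
        using h by (simp add: Z_def g_def)
      also have "\<dots> \<le> h * (L (t + s * h) * norm (u (t + s * h) - (u t - x)))"
        using elim h by (intro mult_left_mono) auto
      also have "norm (u (t + s * h) - (u t - x)) \<le> norm (u (t + s * h) - u t) + norm x"
        using norm_triangle_ineq[of "u (t + s * h) - u t" x] by (simp add: algebra_simps)
      also have "norm (u (t + s * h) - u t) \<le> G"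
        unfolding G_def using t h elim \<open>s * h \<le> h\<close> by (intro norm_solution_increment_le) auto
      finally show ?case using h L_nonneg by (simp add: mult.assoc mult_left_mono)
    qed
  qed
  have "error_step h k x s = x + (Y s + Z s)" for s
    unfolding error_step_def Y_def Z_def t(3) unfolding t_def[symmetric] by (simp add: algebra_simps)
  then have "(\<integral>\<^sup>+s. ennreal (norm (error_step h k x s) powr p) \<partial>unif)
      = (\<integral>\<^sup>+s. ennreal (norm (x + (Y s + Z s)) powr p) \<partial>unif)"
    by simp
  also have "\<dots> \<le> ennreal (norm x powr p + C * (h * (1 + unif.expectation (\<lambda>s. L (t + s * h) powr p))
      * (norm x powr p + G powr p) + h powr (1 - p / 2) * unif.expectation (\<lambda>s. norm (Y s) powr p)))"
    using L_integrable[THEN integrable_unif_affine, OF h(1), of t] L_nonneg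
    by (intro unif.nn_integral_euler_step_le C Y_int Y_mean Yp_int G0 Z) auto
  also have "\<dots> \<le> ennreal (norm x powr p + C * (\<Lambda> h k * norm x powr p
      + (A * (h powr (p / 2) * \<gamma> h k) + 2 * 2 powr p * (h powr (p / 2) * \<gamma> h k))))"
    unfolding LE using G_bound Y_bound C0
    by (intro ennreal_leI add_left_mono mult_left_mono) (auto simp: algebra_simps)
  finally show ?thesis unfolding A_def by (simp add: algebra_simps)
qed

text \<open>
  Freezing the error once its norm exceeds \<open>c\<close> makes the one-step moment bound control the
  maximum over all steps, so that no maximal inequality for martingales is needed.
\<close>

primrec stopped_error :: "real \<Rightarrow> real \<Rightarrow> (nat \<Rightarrow> real) \<Rightarrow> nat \<Rightarrow> 'a" where
  "stopped_error c h \<theta> 0 = 0"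
| "stopped_error c h \<theta> (Suc k) =
     (if c < norm (stopped_error c h \<theta> k) then stopped_error c h \<theta> k
      else error_step h k (stopped_error c h \<theta> k) (\<theta> (Suc k)))"

text \<open>Only the first \<open>k\<close> nodes enter the first \<open>k\<close> steps; this
  expresses the past as a function of a block of variables independent of the next node.\<close>

lemma stopped_error_restrict:
  "{1..k} \<subseteq> A \<Longrightarrow> stopped_error c h (restrict \<theta> A) k = stopped_error c h \<theta> k"
  by (induction k) (auto simp: subset_eq)

lemma stopped_error_measurable:
  "{1..k} \<subseteq> A \<Longrightarrow> (\<lambda>\<theta>. stopped_error c h \<theta> k) \<in> borel_measurable (PiM A (\<lambda>_. borel))"
proof (induction k)
  case (Suc k)
  then have [measurable]: "(\<lambda>\<theta>. stopped_error c h \<theta> k) \<in> borel_measurable (PiM A (\<lambda>_. borel))"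
    by (auto simp: subset_eq)
  have [measurable]: "(\<lambda>\<theta>. \<theta> (Suc k)) \<in> borel_measurable (PiM A (\<lambda>_. borel))"
    using Suc.prems by (intro measurable_component_singleton) auto
  have "(\<lambda>\<theta>. (stopped_error c h \<theta> k, \<theta> (Suc k))) \<in> PiM A (\<lambda>_. borel) \<rightarrow>\<^sub>M borel \<Otimes>\<^sub>M borel"
    by measurable
  from measurable_compose[OF this error_step_measurable]
  have [measurable]: "(\<lambda>\<theta>. error_step h k (stopped_error c h \<theta> k) (\<theta> (Suc k)))
      \<in> borel_measurable (PiM A (\<lambda>_. borel))" by simp
  show ?case by simp
qed simp

lemma random_variable_stopped_error:
  assumes "prob_space M" "prob_space.indep_vars M (\<lambda>_. borel) \<tau> {1..}"
  shows "(\<lambda>\<omega>. stopped_error c h (\<lambda>j. \<tau> j \<omega>) n) \<in> borel_measurable M"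
proof -
  have "(\<lambda>\<omega>. restrict (\<lambda>i. \<tau> i \<omega>) {1..n}) \<in> M \<rightarrow>\<^sub>M PiM {1..n} (\<lambda>_. borel)"
    using assms by (intro measurable_restrict) (auto simp: prob_space.indep_vars_def)
  from measurable_compose[OF this stopped_error_measurable[OF order_refl]]
  show ?thesis by (simp add: stopped_error_restrict)
qed

lemma stopped_error_stays:
  assumes "c < norm (stopped_error c h \<theta> n)" "n \<le> m"
  shows "stopped_error c h \<theta> m = stopped_error c h \<theta> n"
  using assms(2,1) by (induction rule: dec_induct) auto

text \<open>A stopped error above \<open>c\<close> at some step up to \<open>N\<close> would be kept
  until \<open>N\<close>. Hence nothing was frozen, and all these steps are genuine error
  steps.\<close>

lemma error_eq_stopped_error:
  assumes "norm (stopped_error c h \<theta> N) \<le> c" "n \<le> N"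
  shows "u (real n * h) - randomized_euler f u0 h \<theta> n = stopped_error c h \<theta> n"
  using assms(2)
proof (induction n)
  case 0
  have "u 0 = u0"
  proof -
    have "(LINT s:{0..0}|lborel. f s (u s)) = 0"
      unfolding set_lebesgue_integral_def using AE_lborel_singleton[of 0]
      by (intro integral_eq_zero_AE) (auto elim: eventually_mono)
    then show ?thesis using solution[of 0] T_pos by simp
  qed
  then show ?case by simp
next
  case (Suc n)
  have "norm (stopped_error c h \<theta> n) \<le> c"
    using stopped_error_stays[of c h \<theta> n N] assms(1) Suc.prems by fastforce
  moreover have IH: "stopped_error c h \<theta> n = u (real n * h) - randomized_euler f u0 h \<theta> n"
    using Suc by simp
  ultimately have "stopped_error c h \<theta> (Suc n) = error_step h n
      (u (real n * h) - randomized_euler f u0 h \<theta> n) (\<theta> (Suc n))"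
    by simp
  then show ?case by (simp add: error_step_def)
qed

lemma norm_error_le:
  assumes "norm (stopped_error c h \<theta> N) \<le> c" "n \<le> N"
  shows "norm (u (real n * h) - randomized_euler f u0 h \<theta> n) \<le> c"
  using stopped_error_stays[of c h \<theta> n N] assms by (fastforce simp: error_eq_stopped_error)

section \<open>Moment recursion and discrete Gronwall argument\<close>

text \<open>The next node is independent of the error so far, so the one-step bound applies with
  that error frozen as \<open>x\<close>. On the part already stopped the bound is trivial because
  \<open>a\<close> and \<open>b\<close> are nonnegative.\<close>

lemma stopped_error_moment_step:
  fixes M :: "'w measure" and \<tau> :: "nat \<Rightarrow> 'w \<Rightarrow> real"
  assumes M: "prob_space M" and indep: "prob_space.indep_vars M (\<lambda>_. borel) \<tau> {1..}"
    and distr: "\<And>j. 1 \<le> j \<Longrightarrow> distr M borel (\<tau> j) = unif"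
    and step: "\<And>x. (\<integral>\<^sup>+s. ennreal (norm (error_step h k x s) powr p) \<partial>unif)
      \<le> ennreal ((1 + a) * norm x powr p + b)"
    and ab: "0 \<le> a" "0 \<le> b"
  shows "(\<integral>\<^sup>+\<omega>. ennreal (norm (stopped_error c h (\<lambda>j. \<tau> j \<omega>) (Suc k)) powr p) \<partial>M)
    \<le> ennreal (1 + a) * (\<integral>\<^sup>+\<omega>. ennreal (norm (stopped_error c h (\<lambda>j. \<tau> j \<omega>) k) powr p) \<partial>M) + ennreal b"
proof -
  interpret M: prob_space M by fact
  interpret unif: prob_space unif by (rule prob_space_unif)
  define V where "V \<omega> = stopped_error c h (\<lambda>j. \<tau> j \<omega>) k" for \<omega>
  define \<phi> where "\<phi> z = ennreal (norm (if c < norm (fst z) then fst z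
      else error_step h k (fst z) (snd z)) powr p)" for z
  \<comment> \<open>Independence is stated for the blocks \<open>{1..k}\<close> and
    \<open>{Suc k}\<close>; for \<open>k = 0\<close> the first block is empty.\<close>
  have indep_k: "M.indep_var (PiM {1..k} (\<lambda>_. borel)) (\<lambda>\<omega>. restrict (\<lambda>i. \<tau> i \<omega>) {1..k})
      (PiM {Suc k} (\<lambda>_. borel)) (\<lambda>\<omega>. restrict (\<lambda>i. \<tau> i \<omega>) {Suc k})"
    by (rule M.indep_var_restrict[OF indep]) auto
  have [measurable]: "V \<in> borel_measurable M"
    unfolding V_def by (rule random_variable_stopped_error[OF M indep])
  have [measurable]: "\<tau> (Suc k) \<in> borel_measurable M"
    using indep by (simp add: M.indep_vars_def)
  have [measurable]: "(\<lambda>z. error_step h k (fst z) (snd z)) \<in> borel_measurable (borel \<Otimes>\<^sub>M borel)"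
    using error_step_measurable by (simp add: case_prod_beta)
  have \<phi>: "\<phi> \<in> borel_measurable (borel \<Otimes>\<^sub>M borel)"
    unfolding \<phi>_def by measurable
  have \<phi>_comp: "(\<lambda>z. \<phi> (stopped_error c h (fst z) k, snd z (Suc k)))
      \<in> borel_measurable (PiM {1..k} (\<lambda>_. borel) \<Otimes>\<^sub>M PiM {Suc k} (\<lambda>_. borel))"
  proof (rule measurable_compose[OF _ \<phi>])
    have [measurable]: "(\<lambda>\<theta>. stopped_error c h \<theta> k) \<in> borel_measurable (PiM {1..k} (\<lambda>_. borel))"
      by (rule stopped_error_measurable) simp
    have [measurable]: "(\<lambda>\<theta>. \<theta> (Suc k)) \<in> borel_measurable (PiM {Suc k} (\<lambda>_. borel :: real measure))"
      by (rule measurable_component_singleton) simp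
    show "(\<lambda>z. (stopped_error c h (fst z) k, snd z (Suc k)))
        \<in> PiM {1..k} (\<lambda>_. borel) \<Otimes>\<^sub>M PiM {Suc k} (\<lambda>_. borel) \<rightarrow>\<^sub>M borel \<Otimes>\<^sub>M borel"
      by measurable
  qed
  have le: "(\<integral>\<^sup>+s. \<phi> (x, s) \<partial>unif) \<le> ennreal (1 + a) * ennreal (norm x powr p) + ennreal b" for x
  proof -
    have "(\<integral>\<^sup>+s. \<phi> (x, s) \<partial>unif) \<le> ennreal ((1 + a) * norm x powr p + b)"
    proof (cases "c < norm x")
      case True
      then have "(\<integral>\<^sup>+s. \<phi> (x, s) \<partial>unif) = ennreal (norm x powr p)"
        using unif.emeasure_space_1 by (simp add: \<phi>_def)
      also have "\<dots> \<le> ennreal ((1 + a) * norm x powr p + b)"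
        using ab by (intro ennreal_leI) (simp add: distrib_right)
      finally show ?thesis .
    next
      case False
      then show ?thesis using step by (simp add: \<phi>_def)
    qed
    then show ?thesis using ab by (simp add: ennreal_mult ennreal_plus)
  qed
  have "(\<integral>\<^sup>+\<omega>. ennreal (norm (stopped_error c h (\<lambda>j. \<tau> j \<omega>) (Suc k)) powr p) \<partial>M)
      = (\<integral>\<^sup>+\<omega>. \<phi> (V \<omega>, \<tau> (Suc k) \<omega>) \<partial>M)"
    by (simp add: \<phi>_def V_def cong: if_cong)
  also have "\<dots> = (\<integral>\<^sup>+\<omega>. (\<integral>\<^sup>+\<omega>'. \<phi> (V \<omega>, \<tau> (Suc k) \<omega>') \<partial>M) \<partial>M)"
    using M.nn_integral_indep_var[OF indep_k \<phi>_comp] by (simp add: stopped_error_restrict V_def)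
  also have "\<dots> = (\<integral>\<^sup>+\<omega>. (\<integral>\<^sup>+s. \<phi> (V \<omega>, s) \<partial>distr M borel (\<tau> (Suc k))) \<partial>M)"
    using \<phi> by (subst nn_integral_distr) auto
  also have "\<dots> = (\<integral>\<^sup>+\<omega>. (\<integral>\<^sup>+s. \<phi> (V \<omega>, s) \<partial>unif) \<partial>M)"
    by (simp add: distr)
  also have "\<dots> \<le> (\<integral>\<^sup>+\<omega>. ennreal (1 + a) * ennreal (norm (V \<omega>) powr p) + ennreal b \<partial>M)"
    by (intro nn_integral_mono le)
  also have "\<dots> = ennreal (1 + a) * (\<integral>\<^sup>+\<omega>. ennreal (norm (V \<omega>) powr p) \<partial>M) + ennreal b"
    using M.emeasure_space_1 by (simp add: nn_integral_add nn_integral_cmult)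
  finally show ?thesis by (simp add: V_def)
qed

text \<open>Discrete Gronwall: the product of the factors \<open>1 + C * \<Lambda> h k\<close> is at
  most the exponential of their weights' sum. The constant is uniform in the stopping level, the
  step size and the number of steps.\<close>

lemma ex_stopped_error_moment_le:
  "\<exists>K\<ge>0. \<forall>(M :: 'w measure) \<tau> c h n.
    prob_space M \<longrightarrow> prob_space.indep_vars M (\<lambda>_. borel) \<tau> {1..} \<longrightarrow>
    (\<forall>j\<ge>1. distr M borel (\<tau> j) = unif) \<longrightarrow> 0 < h \<longrightarrow> h \<le> 1 \<longrightarrow> real n * h \<le> T \<longrightarrow>
    (\<integral>\<^sup>+\<omega>. ennreal (norm (stopped_error c h (\<lambda>j. \<tau> j \<omega>) n) powr p) \<partial>M) \<le> ennreal (K * h powr (p / 2))"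
proof -
  obtain C where C0: "0 \<le> C" and C: "\<And>(x :: 'a) y z h l G. 0 < h \<Longrightarrow> h \<le> 1 \<Longrightarrow> 0 \<le> l \<Longrightarrow> 0 \<le> G
      \<Longrightarrow> norm z \<le> h * l * (G + norm x) \<Longrightarrow>
      norm (x + (y + z)) powr p \<le> norm x powr p + p * norm x powr (p - 2) * (x \<bullet> y)
      + C * (h * (1 + l powr p) * (norm x powr p + G powr p) + h powr (1 - p / 2) * norm y powr p)"
    using ex_euler_step_powr_le[OF p_ge_2, where 'a = 'a] by blast
  \<comment> \<open>\<open>A\<close> and \<open>B\<close> bound the sums of the weights
    \<open>\<Lambda>\<close> and \<open>\<gamma>\<close>; \<open>D\<close> is the constant of the
    inhomogeneous term in one step.\<close>
  define A where "A = T + (LINT r|lborel. L r powr p)"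
  define B where "B = (LINT r|lborel. norm (g r) powr p)"
  define D where "D = C * (A + 2 * 2 powr p)"
  define K where "K = exp (C * A) * (D * B)"
  have A0: "0 \<le> A" using T_pos by (auto simp: A_def)
  have D0: "0 \<le> D" using C0 A0 by (simp add: D_def)
  have "0 \<le> B" by (simp add: B_def)
  then have K0: "0 \<le> K" using D0 by (simp add: K_def)
  have "(\<integral>\<^sup>+\<omega>. ennreal (norm (stopped_error c h (\<lambda>j. \<tau> j \<omega>) n) powr p) \<partial>M) \<le> ennreal (K * h powr (p / 2))"
    if M: "prob_space M" and indep: "prob_space.indep_vars M (\<lambda>_. borel) \<tau> {1..}"
      and distr: "\<And>j. 1 \<le> j \<Longrightarrow> distr M borel (\<tau> j) = unif"
      and h: "0 < h" "h \<le> 1" and n: "real n * h \<le> T"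
    for M :: "'w measure" and \<tau> c h n
  proof -
    define E where "E k = (\<integral>\<^sup>+\<omega>. ennreal (norm (stopped_error c h (\<lambda>j. \<tau> j \<omega>) k) powr p) \<partial>M)" for k
    define H where "H = h powr (p / 2)"
    have H0: "0 \<le> H" by (simp add: H_def)
    have "E k \<le> ennreal (exp (C * (\<Sum>i<k. \<Lambda> h i)) * (D * H * (\<Sum>i<k. \<gamma> h i)))" if "k \<le> n" for k
      using that
    proof (induction k)
      case 0
      then show ?case by (simp add: E_def)
    next
      case (Suc k)
      define S where "S = C * (\<Sum>i<k. \<Lambda> h i)"
      define \<Gamma> where "\<Gamma> = D * H * (\<Sum>i<k. \<gamma> h i)"
      define a where "a = C * \<Lambda> h k"
      define b where "b = D * H * \<gamma> h k"
      have nn: "0 \<le> S" "0 \<le> \<Gamma>" "0 \<le> a" "0 \<le> b"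
        using C0 D0 H0 h \<Lambda>_nonneg \<gamma>_nonneg
        by (auto simp: S_def \<Gamma>_def a_def b_def intro!: mult_nonneg_nonneg sum_nonneg)
      have "real (Suc k) * h \<le> real n * h"
        using Suc.prems h by (intro mult_right_mono) auto
      with n have k: "real (Suc k) * h \<le> T" by linarith
      have step: "(\<integral>\<^sup>+s. ennreal (norm (error_step h k x s) powr p) \<partial>unif)
          \<le> ennreal ((1 + a) * norm x powr p + b)" for x
        using error_step_moment_le[OF C0 C h k, of x] h by (simp add: a_def b_def D_def A_def H_def)
      have "E (Suc k) \<le> ennreal (1 + a) * E k + ennreal b"
        unfolding E_def by (rule stopped_error_moment_step[OF M indep distr step nn(3,4)])
      also have "\<dots> \<le> ennreal (1 + a) * ennreal (exp S * \<Gamma>) + ennreal b"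
        using Suc by (intro add_right_mono mult_left_mono) (auto simp: S_def \<Gamma>_def)
      also have "\<dots> = ennreal ((1 + a) * (exp S * \<Gamma>) + b)"
        using nn by (simp add: ennreal_mult ennreal_plus)
      also have "\<dots> \<le> ennreal (exp (S + a) * (\<Gamma> + b))"
      \<comment> \<open>The factor \<open>1 + a\<close> is absorbed by \<open>exp a\<close>, and the
        new term \<open>b\<close> may be multiplied by an exponential that is at least 1.\<close>
      proof (rule ennreal_leI)
        have "(1 + a) * (exp S * \<Gamma>) \<le> exp a * (exp S * \<Gamma>)"
          using nn exp_ge_add_one_self[of a] by (intro mult_right_mono) auto
        moreover have "1 * b \<le> exp (S + a) * b"
          using nn by (intro mult_right_mono) auto
        ultimately show "(1 + a) * (exp S * \<Gamma>) + b \<le> exp (S + a) * (\<Gamma> + b)"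
          by (simp add: exp_add algebra_simps)
      qed
      finally show ?case by (simp add: S_def \<Gamma>_def a_def b_def algebra_simps)
    qed
    then have "E n \<le> ennreal (exp (C * (\<Sum>i<n. \<Lambda> h i)) * (D * H * (\<Sum>i<n. \<gamma> h i)))" by simp
    also have "\<dots> \<le> ennreal (exp (C * A) * (D * H * B))"
    proof (intro ennreal_leI mult_mono)
      show "exp (C * (\<Sum>i<n. \<Lambda> h i)) \<le> exp (C * A)"
        unfolding A_def exp_le_cancel_iff using C0 h n by (intro mult_left_mono sum_\<Lambda>_le) auto
      show "(\<Sum>i<n. \<gamma> h i) \<le> B"
        unfolding B_def using h by (intro sum_\<gamma>_le) auto
    qed (use D0 H0 \<gamma>_nonneg in \<open>auto intro!: mult_nonneg_nonneg sum_nonneg\<close>)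
    also have "exp (C * A) * (D * H * B) = K * H" by (simp add: K_def)
    finally show ?thesis by (simp add: E_def H_def)
  qed
  with K0 show ?thesis by blast
qed

section \<open>Tail bound and Borel--Cantelli\<close>

text \<open>Markov's inequality for the \<open>p\<close>-th moment. With the stopping level equal to
  the threshold, the event covers an error above \<open>c\<close> at any step up to
  \<open>n\<close>.\<close>

lemma ex_stopped_error_tail_le:
  fixes M :: "'w measure" and \<tau> :: "nat \<Rightarrow> 'w \<Rightarrow> real"
  assumes M: "prob_space M" and indep: "prob_space.indep_vars M (\<lambda>_. borel) \<tau> {1..}"
    and distr: "\<And>j. 1 \<le> j \<Longrightarrow> distr M borel (\<tau> j) = unif"
  shows "\<exists>K\<ge>0. \<forall>c h n. 0 < c \<longrightarrow> 0 < h \<longrightarrow> h \<le> 1 \<longrightarrow> real n * h \<le> T \<longrightarrow>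
    measure M {\<omega>\<in>space M. c < norm (stopped_error c h (\<lambda>j. \<tau> j \<omega>) n)} \<le> K * h powr (p / 2) / c powr p"
proof -
  interpret M: prob_space M by fact
  obtain K where K0: "0 \<le> K" and K: "\<And>c h n. 0 < h \<Longrightarrow> h \<le> 1 \<Longrightarrow> real n * h \<le> T \<Longrightarrow>
      (\<integral>\<^sup>+\<omega>. ennreal (norm (stopped_error c h (\<lambda>j. \<tau> j \<omega>) n) powr p) \<partial>M) \<le> ennreal (K * h powr (p / 2))"
    using ex_stopped_error_moment_le[where 'w = 'w] assms by meson
  have "measure M {\<omega>\<in>space M. c < norm (stopped_error c h (\<lambda>j. \<tau> j \<omega>) n)} \<le> K * h powr (p / 2) / c powr p"
    (is "measure M ?S \<le> _") if c: "0 < c" and h: "0 < h" "h \<le> 1" "real n * h \<le> T" for c h n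
  proof -
    have [measurable]: "(\<lambda>\<omega>. stopped_error c h (\<lambda>j. \<tau> j \<omega>) n) \<in> borel_measurable M"
      using M indep by (rule random_variable_stopped_error)
    have "ennreal (c powr p) * emeasure M ?S = (\<integral>\<^sup>+\<omega>. ennreal (c powr p) * indicator ?S \<omega> \<partial>M)"
      by (simp add: nn_integral_cmult_indicator)
    also have "\<dots> \<le> (\<integral>\<^sup>+\<omega>. ennreal (norm (stopped_error c h (\<lambda>j. \<tau> j \<omega>) n) powr p) \<partial>M)"
      using c p_ge_2 by (intro nn_integral_mono) (auto simp: indicator_def intro!: ennreal_leI powr_mono2)
    also have "\<dots> \<le> ennreal (K * h powr (p / 2))" using h by (rule K)
    finally have "ennreal (c powr p * measure M ?S) \<le> ennreal (K * h powr (p / 2))"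
      by (simp add: M.emeasure_eq_measure ennreal_mult)
    then have "c powr p * measure M ?S \<le> K * h powr (p / 2)"
      using K0 by (simp add: ennreal_le_iff)
    then show ?thesis using c by (simp add: field_simps)
  qed
  with K0 show ?thesis by blast
qed

lemma randomized_euler_almost_sure_rate:
  fixes M :: "'w measure" and \<tau> :: "nat \<Rightarrow> 'w \<Rightarrow> real" and h :: "nat \<Rightarrow> real"
  assumes M: "prob_space M" and indep: "prob_space.indep_vars M (\<lambda>_. borel) \<tau> {1..}"
    and distr: "\<And>j. 1 \<le> j \<Longrightarrow> distr M borel (\<tau> j) = unif"
    and h: "\<And>m. 1 \<le> m \<Longrightarrow> 0 < h m \<and> h m < 1" and summable: "summable (\<lambda>m. h (Suc m))"
  shows "\<exists>(m0 :: 'w \<Rightarrow> nat) A. m0 \<in> measurable M (count_space UNIV) \<and> A \<in> sets M \<and> measure M A = 1 \<and>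
    (\<forall>\<omega>\<in>A. \<forall>m\<ge>1. m \<ge> m0 \<omega> \<longrightarrow> (\<forall>n\<le>num_steps T (h m).
      norm (u (real n * h m) - randomized_euler f u0 (h m) (\<lambda>j. \<tau> j \<omega>) n) \<le> h m powr (1 / 2 - 1 / p)))"
proof -
  interpret M: prob_space M by fact
  define c where "c m = h m powr (1 / 2 - 1 / p)" for m
  define E where "E m = {\<omega>\<in>space M.
    c m < norm (stopped_error (c m) (h m) (\<lambda>j. \<tau> j \<omega>) (num_steps T (h m)))}" for m
  obtain K where K: "0 \<le> K" "\<And>c h n. 0 < c \<Longrightarrow> 0 < h \<Longrightarrow> h \<le> 1 \<Longrightarrow> real n * h \<le> T \<Longrightarrow>
      measure M {\<omega>\<in>space M. c < norm (stopped_error c h (\<lambda>j. \<tau> j \<omega>) n)} \<le> K * h powr (p / 2) / c powr p"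
    using ex_stopped_error_tail_le[OF M indep distr] by blast
  have E: "M.prob (E m) \<le> K * h m" if "1 \<le> m" for m
  proof -
    have hm: "0 < h m" "h m \<le> 1" using h[OF that] by auto
    have "M.prob (E m) \<le> K * h m powr (p / 2) / c m powr p"
      unfolding E_def using num_steps_bounds(1)[of T "h m"] hm T_pos
      by (intro K(2)) (auto simp: c_def)
    \<comment> \<open>The exponent \<open>1 / 2 - 1 / p\<close> is chosen so that dividing by
      \<open>c m powr p\<close> leaves exactly one power of \<open>h m\<close>, which is
      summable.\<close>
    also have "c m powr p = h m powr (p / 2 - 1)"
    proof -
      have "(1 / 2 - 1 / p) * p = p / 2 - 1" using p_ge_2 by (simp add: left_diff_distrib)
      then show ?thesis by (simp add: c_def powr_powr)
    qed
    also have "K * h m powr (p / 2) / h m powr (p / 2 - 1) = K * h m"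
      using hm by (simp add: powr_diff)
    finally show ?thesis .
  qed
  have "summable (\<lambda>m. K * h m)"
    using summable by (intro summable_mult) (simp add: summable_Suc_iff)
  \<comment> \<open>The value \<open>h 0\<close> is unconstrained, so the comparison starts at index
    1.\<close>
  then have "summable (\<lambda>m. M.prob (E m))"
    by (rule summable_comparison_test'[where N = 1]) (use E in auto)
  moreover have "E m \<in> M.events" for m
  proof -
    note random_variable_stopped_error[OF M indep, measurable]
    show ?thesis unfolding E_def by measurable
  qed
  ultimately obtain m0 :: "'w \<Rightarrow> nat" and A where m0: "m0 \<in> measurable M (count_space UNIV)"
      and A: "A \<in> M.events" "M.prob A = 1" "\<And>\<omega> m. \<omega> \<in> A \<Longrightarrow> m0 \<omega> \<le> m \<Longrightarrow> \<omega> \<notin> E m"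
    using M.ex_random_index_eventually[of E] by metis
  have "norm (u (real n * h m) - randomized_euler f u0 (h m) (\<lambda>j. \<tau> j \<omega>) n) \<le> c m"
    if "\<omega> \<in> A" "m0 \<omega> \<le> m" "n \<le> num_steps T (h m)" for \<omega> m n
  proof -
    have "\<omega> \<in> space M" using that A(1) sets.sets_into_space by auto
    then show ?thesis using A(3)[OF that(1,2)] that(3) by (intro norm_error_le) (auto simp: E_def)
  qed
  with m0 A(1,2) show ?thesis unfolding c_def by blast
qed

end

section \<open>Reduction to data extended by zero\<close>

text \<open>As long as \<open>real n * h \<le> T\<close> and the nodes lie in \<open>[0, 1]\<close>,
  every evaluation time lies in \<open>[0, T]\<close>; the scheme cannot distinguish
  \<open>f\<close> from its extension.\<close>

lemma randomized_euler_cong: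
  assumes "\<And>t x. t \<in> {0..T} \<Longrightarrow> f t x = f' t x" and "0 \<le> h" "\<And>j. 1 \<le> j \<Longrightarrow> \<theta> j \<in> {0..1}"
    and "real n * h \<le> T"
  shows "randomized_euler f u0 h \<theta> n = randomized_euler f' u0 h \<theta> n"
  using assms(4)
proof (induction n)
  case (Suc n)
  have \<theta>: "\<theta> (Suc n) \<in> {0..1}" using assms(3) by simp
  then have "\<theta> (Suc n) * h \<le> h" using assms(2) by (simp add: mult_left_le_one_le)
  then have "real n * h + \<theta> (Suc n) * h \<in> {0..T}" and "real n * h \<le> T"
    using Suc.prems assms(2) \<theta> by (auto simp: algebra_simps)
  then show ?case using Suc.IH assms(1) by simp
qed simp

section \<open>The almost sure rate\<close>

theorem theorem4p5:
  fixes M :: "'w measure" and \<tau> :: "nat \<Rightarrow> 'w \<Rightarrow> real"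
    and T p :: real
    and u0 :: "real ^ 'd"
    and f :: "real \<Rightarrow> real ^ 'd \<Rightarrow> real ^ 'd"
    and L K :: "real \<Rightarrow> real"
    and u :: "real \<Rightarrow> real ^ 'd"
    and h :: "nat \<Rightarrow> real"
  assumes "prob_space M"
    and "prob_space.indep_vars M (\<lambda>_. borel) \<tau> {1..}"
    and "\<And>j. j \<ge> 1 \<Longrightarrow> distr M borel (\<tau> j) = uniform_measure lborel {0<..<1}"
    and "T > 0" and "p > 2"
    and "(\<lambda>(t, x). f t x) \<in> borel_measurable (restrict_space borel ({0..T} \<times> UNIV))"
    and "L \<in> borel_measurable (restrict_space borel {0..T})"
    and "K \<in> borel_measurable (restrict_space borel {0..T})"
    and "\<And>t. t \<in> {0..T} \<Longrightarrow> 0 \<le> L t"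
    and "\<And>t. t \<in> {0..T} \<Longrightarrow> 0 \<le> K t"
    and "(\<integral>\<^sup>+t\<in>{0..T}. ennreal (\<bar>L t\<bar> powr p) \<partial>lborel) < \<infinity>"
    and "(\<integral>\<^sup>+t\<in>{0..T}. ennreal (\<bar>K t\<bar> powr p) \<partial>lborel) < \<infinity>"
    and "AE t in lborel. t \<in> {0..T} \<longrightarrow>
           (\<forall>x1 x2. norm (f t x1 - f t x2) \<le> L t * norm (x1 - x2))"
    and "AE t in lborel. t \<in> {0..T} \<longrightarrow> norm (f t 0) \<le> K t"
    and "ivp_solution T f u0 u"
    and "\<And>m. m \<ge> 1 \<Longrightarrow> 0 < h m \<and> h m < 1"
    and "summable (\<lambda>m. h (Suc m))"
  shows "\<exists>(m0 :: 'w \<Rightarrow> nat) A.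
           m0 \<in> measurable M (count_space UNIV) \<and>
           A \<in> sets M \<and> measure M A = 1 \<and>
           (\<forall>\<omega>\<in>A. \<forall>m\<ge>1. m \<ge> m0 \<omega> \<longrightarrow>
              (MAX n\<in>{0..num_steps T (h m)}.
                 norm (u (real n * h m) - randomized_euler f u0 (h m) (\<lambda>j. \<tau> j \<omega>) n))
              \<le> h m powr (1 / 2 - 1 / p))"
proof -
  interpret M: prob_space M by fact
  note indep = assms(2) and distr = assms(3) and T = assms(4) and p = assms(5) and h = assms(16)
  \<comment> \<open>Extension by zero carries measurability, integrability and the Lipschitz bound
    from \<open>[0, T]\<close> to the whole line; outside the interval both sides of the latter
    vanish.\<close>
  define ext :: "(real \<Rightarrow> real) \<Rightarrow> real \<Rightarrow> real" where "ext \<phi> t = indicator {0..T} t * \<phi> t" for \<phi> t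
  define f' where "f' t x = indicat_real {0..T} t *\<^sub>R f t x" for t x
  have ext_powr_integrable: "integrable lborel (\<lambda>t. ext \<phi> t powr p)"
    if \<phi>: "\<phi> \<in> borel_measurable (restrict_space borel {0..T})" "\<And>t. t \<in> {0..T} \<Longrightarrow> 0 \<le> \<phi> t"
      and fin: "(\<integral>\<^sup>+t\<in>{0..T}. ennreal (\<bar>\<phi> t\<bar> powr p) \<partial>lborel) < \<infinity>" for \<phi>
  proof (rule integrableI_bounded)
    have "ext \<phi> \<in> borel_measurable borel"
      using \<phi>(1) unfolding ext_def[abs_def] by (subst (asm) borel_measurable_restrict_space_iff) auto
    then show "(\<lambda>t. ext \<phi> t powr p) \<in> borel_measurable lborel" by simp
    have "(\<integral>\<^sup>+t. ennreal (norm (ext \<phi> t powr p)) \<partial>lborel)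
        = (\<integral>\<^sup>+t\<in>{0..T}. ennreal (\<bar>\<phi> t\<bar> powr p) \<partial>lborel)"
      using \<phi>(2) by (intro nn_integral_cong) (auto simp: ext_def indicator_def)
    then show "(\<integral>\<^sup>+t. ennreal (norm (ext \<phi> t powr p)) \<partial>lborel) < \<infinity>" using fin by simp
  qed
  have L_int: "integrable lborel (\<lambda>t. ext L t powr p)"
    by (intro ext_powr_integrable assms)
  have K_int: "integrable lborel (\<lambda>t. ext K t powr p)"
    by (intro ext_powr_integrable assms)
  have L_nonneg: "0 \<le> ext L t" and K_nonneg: "0 \<le> ext K t" for t
    using assms(9,10) by (auto simp: ext_def indicator_def)
  have f'_meas: "(\<lambda>(t, x). f' t x) \<in> borel_measurable (borel \<Otimes>\<^sub>M borel)"
  proof -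
    have "(\<lambda>z. indicat_real ({0..T} \<times> UNIV) z *\<^sub>R (case z of (t, x) \<Rightarrow> f t x)) \<in> borel_measurable borel"
      using assms(6) by (subst (asm) borel_measurable_restrict_space_iff) (auto simp: borel_prod[symmetric])
    moreover have "(\<lambda>z. indicat_real ({0..T} \<times> UNIV) z *\<^sub>R (case z of (t, x) \<Rightarrow> f t x)) = (\<lambda>(t, x). f' t x)"
      by (auto simp: f'_def indicator_def fun_eq_iff)
    ultimately show ?thesis by (simp add: borel_prod)
  qed
  have lip: "AE t in lborel. \<forall>x y. norm (f' t x - f' t y) \<le> ext L t * norm (x - y)"
    using assms(13) by eventually_elim (auto simp: f'_def ext_def indicator_def)
  have rhs: "integrable lborel (\<lambda>t. f' t (u t))"
    using assms(15) unfolding ivp_solution_def set_integrable_def f'_def by simp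
  have sol: "u t = u0 + (LINT s:{0..t}|lborel. f' s (u s))" if "t \<in> {0..T}" for t
  proof -
    have "(LINT s:{0..t}|lborel. f s (u s)) = (LINT s:{0..t}|lborel. f' s (u s))"
      using that by (intro set_lebesgue_integral_cong) (auto simp: f'_def)
    then show ?thesis using assms(15) that unfolding ivp_solution_def by simp
  qed
  \<comment> \<open>\<open>B\<close> bounds the solution on \<open>[0, T]\<close> through the
    integral equation. The growth and Lipschitz bounds then give the \<open>p\<close>-integrable
    majorant \<open>ext K t + B * ext L t\<close> for the right-hand side along
    \<open>u\<close>.\<close>
  define B where "B = norm u0 + (LINT t|lborel. norm (f' t (u t)))"
  have u_le: "norm (u t) \<le> B" if t: "t \<in> {0..T}" for t
  proof -
    have int: "set_integrable lborel {0..t} (\<lambda>s. f' s (u s))"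
      using rhs unfolding set_integrable_def by (intro integrable_mult_indicator) auto
    have "norm (LINT s:{0..t}|lborel. f' s (u s)) \<le> (LINT s:{0..t}|lborel. norm (f' s (u s)))"
      using int by (rule set_integral_norm_bound)
    also have "\<dots> \<le> (LINT s|lborel. norm (f' s (u s)))"
      unfolding set_lebesgue_integral_def
      using set_integrable_norm[OF int] rhs unfolding set_integrable_def
      by (intro integral_mono) (auto simp: indicator_def)
    finally show ?thesis
      using sol[OF t] norm_triangle_ineq[of u0 "LINT s:{0..t}|lborel. f' s (u s)"] by (simp add: B_def)
  qed
  have B0: "0 \<le> B" by (simp add: B_def)
  have rhs_le: "AE t in lborel. norm (f' t (u t)) powr p
      \<le> 2 powr p * (ext K t powr p + B powr p * ext L t powr p)"
    using assms(13,14)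
  proof eventually_elim
    case (elim t)
    have "norm (f' t (u t)) \<le> ext K t + B * ext L t"
    proof (cases "t \<in> {0..T}")
      case True
      have "norm (f t (u t)) \<le> norm (f t (u t) - f t 0) + norm (f t 0)"
        using norm_triangle_sub[of "f t (u t)" "f t 0"] by simp
      also have "norm (f t (u t) - f t 0) \<le> L t * norm (u t - 0)" using elim True by blast
      also have "\<dots> \<le> L t * B" using u_le True assms(9) by (intro mult_left_mono) auto
      also have "norm (f t 0) \<le> K t" using elim True by blast
      finally show ?thesis using True by (simp add: f'_def ext_def mult.commute)
    qed (simp add: f'_def ext_def)
    then have "norm (f' t (u t)) powr p \<le> (ext K t + B * ext L t) powr p"
      using p by (intro powr_mono2) auto
    also have "\<dots> \<le> 2 powr p * (ext K t powr p + (B * ext L t) powr p)"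
      using p K_nonneg L_nonneg B0 by (intro powr_add_le) auto
    finally show ?case using L_nonneg B0 by (simp add: powr_mult)
  qed
  have rhs_powr: "integrable lborel (\<lambda>t. norm (f' t (u t)) powr p)"
  proof (rule Bochner_Integration.integrable_bound)
    show "integrable lborel (\<lambda>t. 2 powr p * (ext K t powr p + B powr p * ext L t powr p))"
      using K_int L_int by simp
    have "(\<lambda>t. f' t (u t)) \<in> borel_measurable lborel" using rhs by simp
    then show "(\<lambda>t. norm (f' t (u t)) powr p) \<in> borel_measurable lborel" by simp
    show "AE t in lborel. norm (norm (f' t (u t)) powr p)
        \<le> norm (2 powr p * (ext K t powr p + B powr p * ext L t powr p))"
      using rhs_le by eventually_elim (auto intro: order_trans[OF _ abs_ge_self])
  qed
  interpret caratheodory_ivp T p f' "ext L" u u0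
    using T p by unfold_locales (auto intro!: f'_meas L_nonneg L_int lip rhs rhs_powr sol)
  obtain m0 :: "'w \<Rightarrow> nat" and A where m0: "m0 \<in> measurable M (count_space UNIV)"
    and A: "A \<in> sets M" "measure M A = 1" "\<And>\<omega> m n. \<omega> \<in> A \<Longrightarrow> 1 \<le> m \<Longrightarrow> m0 \<omega> \<le> m \<Longrightarrow>
      n \<le> num_steps T (h m) \<Longrightarrow>
      norm (u (real n * h m) - randomized_euler f' u0 (h m) (\<lambda>j. \<tau> j \<omega>) n) \<le> h m powr (1 / 2 - 1 / p)"
    using randomized_euler_almost_sure_rate[OF M.prob_space_axioms indep distr h assms(17)] by metis
  \<comment> \<open>The nodes lie in \<open>[0, 1]\<close> only almost surely. Intersecting over
    countably many of them costs a null set, and on \<open>A'\<close> the schemes for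
    \<open>f\<close> and \<open>f'\<close> coincide.\<close>
  define A' where "A' = {\<omega>\<in>A. \<forall>j. \<tau> (Suc j) \<omega> \<in> {0..1}}"
  have [measurable]: "\<tau> (Suc j) \<in> borel_measurable M" for j
    using indep by (simp add: M.indep_vars_def)
  note A(1)[measurable]
  have A'_sets: "A' \<in> sets M"
  proof -
    have "A' = {\<omega>\<in>space M. \<omega> \<in> A \<and> (\<forall>j. \<tau> (Suc j) \<omega> \<in> {0..1})}"
      using sets.sets_into_space[OF A(1)] by (auto simp: A'_def)
    also have "\<dots> \<in> sets M" by measurable
    finally show ?thesis .
  qed
  have "AE \<omega> in M. \<tau> (Suc j) \<omega> \<in> {0..1}" for j
  proof -
    have "AE s in unif. s \<in> {0..1}" by (intro AE_uniform_measureI) auto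
    then have "AE s in distr M borel (\<tau> (Suc j)). s \<in> {0..1}" by (simp only: distr le_add1 One_nat_def Suc_le_mono le0)
    then show ?thesis by (rule AE_distrD[rotated]) simp
  qed
  then have "AE \<omega> in M. \<forall>j. \<tau> (Suc j) \<omega> \<in> {0..1}" by (simp only: AE_all_countable) simp
  moreover have "AE \<omega> in M. \<omega> \<in> A" using A(1,2) by (simp add: M.prob_eq_1)
  ultimately have "AE \<omega> in M. \<omega> \<in> A'" by eventually_elim (simp add: A'_def)
  then have A'_prob: "measure M A' = 1" using A'_sets by (simp add: M.prob_eq_1)
  have "(MAX n\<in>{0..num_steps T (h m)}.
      norm (u (real n * h m) - randomized_euler f u0 (h m) (\<lambda>j. \<tau> j \<omega>) n)) \<le> h m powr (1 / 2 - 1 / p)"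
    if \<omega>: "\<omega> \<in> A'" and m: "1 \<le> m" "m0 \<omega> \<le> m" for \<omega> m
  proof -
    have hm: "0 < h m" using h[OF m(1)] by simp
    have "norm (u (real n * h m) - randomized_euler f u0 (h m) (\<lambda>j. \<tau> j \<omega>) n) \<le> h m powr (1 / 2 - 1 / p)"
      if n: "n \<le> num_steps T (h m)" for n
    proof -
      have "real n * h m \<le> real (num_steps T (h m)) * h m"
        using n hm by (intro mult_right_mono) auto
      also have "\<dots> \<le> T" using num_steps_bounds(1)[of T "h m"] T hm by simp
      finally have nh: "real n * h m \<le> T" .
      have "randomized_euler f u0 (h m) (\<lambda>j. \<tau> j \<omega>) n = randomized_euler f' u0 (h m) (\<lambda>j. \<tau> j \<omega>) n"
      proof (rule randomized_euler_cong[where T = T])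
        show "\<tau> j \<omega> \<in> {0..1}" if "1 \<le> j" for j
          using \<omega> that by (cases j) (auto simp: A'_def)
      qed (use hm nh in \<open>auto simp: f'_def\<close>)
      then show ?thesis using A(3)[OF _ m n] \<omega> by (simp add: A'_def)
    qed
    then show ?thesis by (subst Max_le_iff) auto
  qed
  with m0 A'_sets A'_prob show ?thesis by blast
qed

end
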